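(* Let $\mathfrak{G}_\Gamma$ be a finite $(q+1)$-regular graph with $q>1$ and fix $\vartheta\in(0,1)$. Consider the unweighted resolvent $\mathbf{R}(s)=(\mathrm{Id}-q^{\frac12+is}\mathcal{L}_{\Gamma,+})^{-1}$ on $\mathcal{F}_\vartheta(\mathfrak{P}_\Gamma^+)$. Let $f\in C^{\mathrm{lc}}(\mathfrak{P}_\Gamma)$, and let $f_+\in C^{\mathrm{lc}}(\mathfrak{P}_\Gamma^+)\subset\mathcal{F}_\vartheta(\mathfrak{P}_\Gamma^+)$ be its one-sided reduction, i.e. $f\circ\sigma^m=f_+\circ\pi_+$ for some $m\geq1$, viewed as a bounded multiplication operator $M_{f_+}$ on $\mathcal{F}_\vartheta(\mathfrak{P}_\Gamma^+)$. Then, for $\mathrm{Im}(s)>\frac32$, the weighted trace formula holds: $$\mathrm{Tr}\big[\mathbf{R}(s)f_+\big]:=\mathrm{Tr}\big[M_{f_+}\mathbf{R}(s)\big]=\mathbf{Z}_f(s).$$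
   Context: $\mathfrak{G}_\Gamma=(\mathfrak{X}_\Gamma,\mathfrak{E}_\Gamma)$ is a finite connected simple $(q+1)$-regular graph with directed edges closed under reversal; $\iota,\tau$ denote the initial and terminal vertex of an edge and $\vec e^{\,\mathrm{op}}$ the reversed edge. A sequence of edges is admissible if consecutive edges $\vec a,\vec b$ satisfy $\tau(\vec a)=\iota(\vec b)$ and $\vec b\neq\vec a^{\,\mathrm{op}}$. $\mathfrak{P}_\Gamma^+$: admissible right-infinite sequences $(\vec e_1,\vec e_2,\ldots)$, with shift $\sigma_+$ dropping $\vec e_1$; $\mathfrak{P}_\Gamma^-$: admissible left-infinite sequences $(\ldots,\vec e_2,\vec e_1)$. $\mathfrak{P}_\Gamma\subset\mathfrak{P}_\Gamma^+\times\mathfrak{P}_\Gamma^-$: pairs $((\vec e_1,\ldots),(\ldots,\vec b_1))$ with $\iota(\vec e_1)=\tau(\vec b_1)$ and $\vec e_1\neq\vec b_1^{\,\mathrm{op}}$, with shift $\sigma((\vec e_1,\vec e_2,\ldots),(\ldots,\vec b_1))=((\vec e_2,\ldots),(\ldots,\vec b_1,\vec e_1))$; $\pi_+:\mathfrak{P}_\Gamma\to\mathfrak{P}_\Gamma^+$ is the projection. $C^{\mathrm{lc}}$: locally constant complex functions. $F_m(\mathfrak{P}_\Gamma^+)$: functions depending only on the first $m$ edges. $(\mathcal{L}_{\Gamma,+}\varphi)(\mathbf{p})=\sum_{\sigma_+(\mathbf{p}')=\mathbf{p}}\varphi(\mathbf{p}')$ is the unweighted transfer operator. $\mathcal{F}_\vartheta(\mathfrak{P}_\Gamma^+)$: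 functions that are Lipschitz for $d_\vartheta(\mathbf{p},\mathbf{p}')=\vartheta^\kappa$, $\kappa$ the smallest index $i\geq1$ at which the edges differ (and $d_\vartheta(\mathbf p,\mathbf p)=0$), with norm (Lipschitz constant) $+\ \|\cdot\|_\infty$. Trace: for $\mathrm{Im}(s)>\frac32$ the resolvent is given by the Neumann series $\mathbf{R}(s)=\sum_{n\geq0}(q^{\frac12+is}\mathcal{L}_{\Gamma,+})^n$ and the trace is taken termwise, $\mathrm{Tr}[M_{f_+}\mathbf{R}(s)]=\sum_{n\geq0}q^{n(\frac12+is)}\mathrm{Tr}[M_{f_+}\mathcal{L}_{\Gamma,+}^n]$, where $\mathrm{Tr}$ is the flat (algebraic) trace, i.e. it is computed from the finite-dimensional matrix on $F_m(\mathfrak{P}_\Gamma^+)$ with $m$ sufficiently large (in particular $f_+\in F_m(\mathfrak{P}_\Gamma^+)$). Zeta function: a closed path of length $n\geq3$ is an admissible $(\vec e_1,\ldots,\vec e_n)$ with $\tau(\vec e_n)=\iota(\vec e_1)$ and $\vec e_1\neq\vec e_n^{\,\mathrm{op}}$; it is primitive if it is not a repetition of a shorter closed path. $\mathscr{P}_0$ is the set of primitive closed paths modulo cyclic rotation, $\ell_0$ the length of $[\mathbf{p}_0]\in\mathscr{P}_0$, $\widehat{\mathbf{p}}_0\in\mathfrak{P}_\Gamma$ the bi-infinite periodic repetition of a representative, and $$\mathbf{Z}_f(s)=\sum_{[\mathbf{p}_0]\in\mathscr{P}_0}\frac{q^{(\frac12+is)\ell_0}}{1-q^{(\frac12+is)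\ell_0}}\sum_{k=0}^{\ell_0-1}f(\sigma^k(\widehat{\mathbf{p}}_0)).$$
   Formalization: The n = 0 term Tr[M_{f_+}] of the Neumann series is taken to be 0, since its trace on F_m is multiplied by q as m grows by 1, so it has no stable nonzero value; with a fixed m and f = 1 the formula would be off by dim F_m. *)

theory Defs
  imports "HOL-Analysis.Analysis" "Graph_Theory.Graph_Theory"
begin

text \<open>
  Graphs are those of the locale \<^locale>\<open>pair_graph\<close>: a directed edge is a pair of vertices,
  \<^const>\<open>fst\<close> is its initial vertex, \<^const>\<open>snd\<close> its terminal vertex and \<^const>\<open>prod.swap\<close> reverses
  it. Sequences of edges are indexed from 0, so \<open>p i\<close> is the edge usually written \<open>e\<^sub>i\<^sub>+\<^sub>1\<close>.
\<close>

section \<open>Path spaces and shifts\<close>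

definition follows :: "'v \<times> 'v \<Rightarrow> 'v \<times> 'v \<Rightarrow> bool" where
  "follows a b \<longleftrightarrow> snd a = fst b \<and> b \<noteq> prod.swap a"

definition right_paths :: "'v pair_pre_digraph \<Rightarrow> (nat \<Rightarrow> 'v \<times> 'v) set" where
  "right_paths G = {p. (\<forall>i. p i \<in> parcs G) \<and> (\<forall>i. follows (p i) (p (Suc i)))}"

text \<open>A left-infinite path \<open>(\<dots>, b 1, b 0)\<close> is indexed from its right end.\<close>

definition left_paths :: "'v pair_pre_digraph \<Rightarrow> (nat \<Rightarrow> 'v \<times> 'v) set" where
  "left_paths G = {b. (\<forall>i. b i \<in> parcs G) \<and> (\<forall>i. follows (b (Suc i)) (b i))}"

type_synonym 'v bi_path = "(nat \<Rightarrow> 'v \<times> 'v) \<times> (nat \<Rightarrow> 'v \<times> 'v)"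

definition bi_paths :: "'v pair_pre_digraph \<Rightarrow> 'v bi_path set" where
  "bi_paths G = {(p, b). p \<in> right_paths G \<and> b \<in> left_paths G \<and> follows (b 0) (p 0)}"

definition right_shift :: "(nat \<Rightarrow> 'v \<times> 'v) \<Rightarrow> (nat \<Rightarrow> 'v \<times> 'v)" where
  "right_shift p = (\<lambda>i. p (Suc i))"

definition bi_shift :: "'v bi_path \<Rightarrow> 'v bi_path" where
  "bi_shift x = (right_shift (fst x), case_nat (fst x 0) (snd x))"

section \<open>Function spaces\<close>

text \<open>
  The path spaces carry the topology induced by the product of discrete topologies. A complex
  function on a path space is represented by its extension by zero to the whole type.
\<close>

definition right_top :: "'v pair_pre_digraph \<Rightarrow> (nat \<Rightarrow> 'v \<times> 'v) topology" where
  "right_top G = subtopology (product_topology (\<lambda>_. discrete_topology (parcs G)) UNIV) (right_paths G)"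

definition left_top :: "'v pair_pre_digraph \<Rightarrow> (nat \<Rightarrow> 'v \<times> 'v) topology" where
  "left_top G = subtopology (product_topology (\<lambda>_. discrete_topology (parcs G)) UNIV) (left_paths G)"

definition bi_top :: "'v pair_pre_digraph \<Rightarrow> 'v bi_path topology" where
  "bi_top G = subtopology (prod_topology (right_top G) (left_top G)) (bi_paths G)"

definition C_lc :: "'x topology \<Rightarrow> ('x \<Rightarrow> complex) set" where
  "C_lc X = {f. (\<forall>x\<in>topspace X. \<exists>U. openin X U \<and> x \<in> U \<and> f constant_on U) \<and>
                (\<forall>x. x \<notin> topspace X \<longrightarrow> f x = 0)}"

definition F_fin :: "'v pair_pre_digraph \<Rightarrow> nat \<Rightarrow> ((nat \<Rightarrow> 'v \<times> 'v) \<Rightarrow> complex) set" where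
  "F_fin G m = {\<phi>. (\<forall>p\<in>right_paths G. \<forall>p'\<in>right_paths G. (\<forall>i<m. p i = p' i) \<longrightarrow> \<phi> p = \<phi> p') \<and>
                   (\<forall>p. p \<notin> right_paths G \<longrightarrow> \<phi> p = 0)}"

definition d_theta :: "real \<Rightarrow> (nat \<Rightarrow> 'v \<times> 'v) \<Rightarrow> (nat \<Rightarrow> 'v \<times> 'v) \<Rightarrow> real" where
  "d_theta \<theta> p p' = (if p = p' then 0 else \<theta> ^ Suc (LEAST i. p i \<noteq> p' i))"

definition lip_bounds ::
  "'v pair_pre_digraph \<Rightarrow> real \<Rightarrow> ((nat \<Rightarrow> 'v \<times> 'v) \<Rightarrow> complex) \<Rightarrow> real set" where
  "lip_bounds G \<theta> \<phi> = {C. 0 \<le> C \<and>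
     (\<forall>p\<in>right_paths G. \<forall>p'\<in>right_paths G. cmod (\<phi> p - \<phi> p') \<le> C * d_theta \<theta> p p')}"

definition F_theta ::
  "'v pair_pre_digraph \<Rightarrow> real \<Rightarrow> ((nat \<Rightarrow> 'v \<times> 'v) \<Rightarrow> complex) set" where
  "F_theta G \<theta> = {\<phi>. lip_bounds G \<theta> \<phi> \<noteq> {} \<and> (\<forall>p. p \<notin> right_paths G \<longrightarrow> \<phi> p = 0)}"

definition norm_theta ::
  "'v pair_pre_digraph \<Rightarrow> real \<Rightarrow> ((nat \<Rightarrow> 'v \<times> 'v) \<Rightarrow> complex) \<Rightarrow> real" where
  "norm_theta G \<theta> \<phi> = Inf (lip_bounds G \<theta> \<phi>) + (SUP p\<in>right_paths G. cmod (\<phi> p))"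

section \<open>Operators and the resolvent\<close>

type_synonym 'v path_op = "((nat \<Rightarrow> 'v \<times> 'v) \<Rightarrow> complex) \<Rightarrow> ((nat \<Rightarrow> 'v \<times> 'v) \<Rightarrow> complex)"

definition bounded_op :: "'v pair_pre_digraph \<Rightarrow> real \<Rightarrow> 'v path_op \<Rightarrow> bool" where
  "bounded_op G \<theta> A \<longleftrightarrow>
     (\<forall>\<phi>\<in>F_theta G \<theta>. A \<phi> \<in> F_theta G \<theta>) \<and>
     (\<forall>\<phi>\<in>F_theta G \<theta>. \<forall>\<psi>\<in>F_theta G \<theta>. A (\<lambda>p. \<phi> p + \<psi> p) = (\<lambda>p. A \<phi> p + A \<psi> p)) \<and>
     (\<forall>c. \<forall>\<phi>\<in>F_theta G \<theta>. A (\<lambda>p. c * \<phi> p) = (\<lambda>p. c * A \<phi> p)) \<and>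
     (\<exists>C. \<forall>\<phi>\<in>F_theta G \<theta>. norm_theta G \<theta> (A \<phi>) \<le> C * norm_theta G \<theta> \<phi>)"

text \<open>Convergence of a sequence of operators in the operator norm.\<close>

definition op_tendsto ::
  "'v pair_pre_digraph \<Rightarrow> real \<Rightarrow> (nat \<Rightarrow> 'v path_op) \<Rightarrow> 'v path_op \<Rightarrow> bool" where
  "op_tendsto G \<theta> A B \<longleftrightarrow>
     (\<forall>\<epsilon>>0. \<forall>\<^sub>F N in sequentially. \<forall>\<phi>\<in>F_theta G \<theta>.
        norm_theta G \<theta> (\<lambda>p. A N \<phi> p - B \<phi> p) \<le> \<epsilon> * norm_theta G \<theta> \<phi>)"

definition mult_op :: "((nat \<Rightarrow> 'v \<times> 'v) \<Rightarrow> complex) \<Rightarrow> 'v path_op" where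
  "mult_op g \<phi> = (\<lambda>p. g p * \<phi> p)"

definition transfer_op :: "'v pair_pre_digraph \<Rightarrow> 'v path_op" where
  "transfer_op G \<phi> = (\<lambda>p. if p \<in> right_paths G
     then \<Sum>p' | p' \<in> right_paths G \<and> right_shift p' = p. \<phi> p' else 0)"

definition weight :: "nat \<Rightarrow> complex \<Rightarrow> complex" where
  "weight q s = of_nat q powr (1 / 2 + \<i> * s)"

definition id_minus_transfer :: "'v pair_pre_digraph \<Rightarrow> nat \<Rightarrow> complex \<Rightarrow> 'v path_op" where
  "id_minus_transfer G q s \<phi> = (\<lambda>p. \<phi> p - weight q s * transfer_op G \<phi> p)"

definition resolvent :: "'v pair_pre_digraph \<Rightarrow> nat \<Rightarrow> real \<Rightarrow> complex \<Rightarrow> 'v path_op" where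
  "resolvent G q \<theta> s = inv_into (F_theta G \<theta>) (id_minus_transfer G q s)"

definition neumann_sum :: "'v pair_pre_digraph \<Rightarrow> nat \<Rightarrow> complex \<Rightarrow> nat \<Rightarrow> 'v path_op" where
  "neumann_sum G q s N \<phi> = (\<lambda>p. \<Sum>n<N. weight q s ^ n * (transfer_op G ^^ n) \<phi> p)"

section \<open>The flat trace\<close>

definition words :: "'v pair_pre_digraph \<Rightarrow> nat \<Rightarrow> ('v \<times> 'v) list set" where
  "words G m = (\<lambda>p. map p [0..<m]) ` right_paths G"

definition cylinder :: "'v pair_pre_digraph \<Rightarrow> ('v \<times> 'v) list \<Rightarrow> (nat \<Rightarrow> 'v \<times> 'v) set" where
  "cylinder G w = {p \<in> right_paths G. map p [0..<length w] = w}"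

text \<open>
  The matrix of an operator that preserves \<open>F_fin G m\<close>, in the basis given by the indicator
  functions of the cylinders of length \<open>m\<close>. The image of a basis vector is constant on each
  cylinder, so the chosen point does not matter.
\<close>

definition op_matrix ::
  "'v pair_pre_digraph \<Rightarrow> 'v path_op \<Rightarrow> ('v \<times> 'v) list \<Rightarrow> ('v \<times> 'v) list \<Rightarrow> complex" where
  "op_matrix G A v w = A (indicator (cylinder G w)) (SOME p. p \<in> cylinder G v)"

definition fin_trace :: "'v pair_pre_digraph \<Rightarrow> nat \<Rightarrow> 'v path_op \<Rightarrow> complex" where
  "fin_trace G m A = (\<Sum>w\<in>words G m. op_matrix G A w w)"

text \<open>
  The flat trace is the common value of the matrix traces on \<open>F_fin G m\<close> for all sufficiently
  large \<open>m\<close>. If the matrix traces do not stabilise, it is set to 0. This matters for the term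
  \<open>n = 0\<close> of the resolvent trace: on a \<open>(q + 1)\<close>-regular graph the matrix trace of a multiplication
  operator is multiplied by \<open>q\<close> when \<open>m\<close> grows by 1, so for \<open>q > 1\<close> it either vanishes for large
  \<open>m\<close> or does not stabilise. Thus the \<open>n = 0\<close> term contributes 0, in accordance with the fact
  that the flat trace of the \<open>n\<close>-th power counts closed paths of length \<open>n\<close>.
\<close>

definition flat_trace :: "'v pair_pre_digraph \<Rightarrow> 'v path_op \<Rightarrow> complex" where
  "flat_trace G A =
     (if \<exists>t. \<forall>\<^sub>F m in sequentially. fin_trace G m A = t
      then THE t. \<forall>\<^sub>F m in sequentially. fin_trace G m A = t
      else 0)"

text \<open>
  The trace of \<open>mult_op g\<close> composed with the resolvent at \<open>s\<close>, taken termwise in the Neumann series.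
\<close>

definition resolvent_trace_term ::
  "'v pair_pre_digraph \<Rightarrow> nat \<Rightarrow> ((nat \<Rightarrow> 'v \<times> 'v) \<Rightarrow> complex) \<Rightarrow> complex \<Rightarrow> nat \<Rightarrow> complex" where
  "resolvent_trace_term G q g s n =
     of_nat q powr (of_nat n * (1 / 2 + \<i> * s)) * flat_trace G (mult_op g \<circ> (transfer_op G ^^ n))"

definition resolvent_trace ::
  "'v pair_pre_digraph \<Rightarrow> nat \<Rightarrow> ((nat \<Rightarrow> 'v \<times> 'v) \<Rightarrow> complex) \<Rightarrow> complex \<Rightarrow> complex" where
  "resolvent_trace G q g s = (\<Sum>n. resolvent_trace_term G q g s n)"

section \<open>The zeta function\<close>

definition closed_path :: "'v pair_pre_digraph \<Rightarrow> ('v \<times> 'v) list \<Rightarrow> bool" where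
  "closed_path G es \<longleftrightarrow> 3 \<le> length es \<and> set es \<subseteq> parcs G \<and>
     successively follows es \<and> follows (last es) (hd es)"

definition primitive_path :: "'v pair_pre_digraph \<Rightarrow> ('v \<times> 'v) list \<Rightarrow> bool" where
  "primitive_path G es \<longleftrightarrow> closed_path G es \<and>
     \<not> (\<exists>cs k. closed_path G cs \<and> length cs < length es \<and> es = concat (replicate k cs))"

definition primitive_classes :: "'v pair_pre_digraph \<Rightarrow> ('v \<times> 'v) list set set" where
  "primitive_classes G = {es. primitive_path G es} //
     {(es, fs). primitive_path G es \<and> primitive_path G fs \<and> (\<exists>k. fs = rotate k es)}"

definition periodic_path :: "('v \<times> 'v) list \<Rightarrow> 'v bi_path" where
  "periodic_path es =
     (\<lambda>i. es ! (i mod length es), \<lambda>i. es ! (length es - 1 - i mod length es))"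

definition zeta_term ::
  "nat \<Rightarrow> ('v bi_path \<Rightarrow> complex) \<Rightarrow> complex \<Rightarrow> ('v \<times> 'v) list set \<Rightarrow> complex" where
  "zeta_term q f s c =
     (let es = (SOME es. es \<in> c); l = length es;
          w = of_nat q powr ((1 / 2 + \<i> * s) * of_nat l)
      in w / (1 - w) * (\<Sum>k<l. f ((bi_shift ^^ k) (periodic_path es))))"

definition zeta ::
  "'v pair_pre_digraph \<Rightarrow> nat \<Rightarrow> ('v bi_path \<Rightarrow> complex) \<Rightarrow> complex \<Rightarrow> complex" where
  "zeta G q f s = (\<Sum>\<^sub>\<infinity>c\<in>primitive_classes G. zeta_term q f s c)"

end

theory Submission
  imports Defs
begin

text \<open>
  A path has \<open>q ^ n\<close> preimages under the \<open>n\<close>-th power of the shift, so on \<open>F_theta\<close> the \<open>n\<close>-th power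
  of the transfer operator has norm \<open>O(q ^ n)\<close>, while the weight is smaller than \<open>1 / q\<close> in modulus
  for \<open>Im s > 3 / 2\<close>: the Neumann series converges. On a cylinder, preimages of a point under the
  \<open>n\<close>-th shift correspond to \<open>n\<close>-periodic paths, so the flat trace of \<open>mult_op g\<close> composed with the
  \<open>n\<close>-th power is the sum of \<open>g\<close> over the \<open>n\<close>-periodic paths. A periodic path with minimal period
  \<open>l\<close> is \<open>n\<close>-periodic iff \<open>l\<close> divides \<open>n\<close>; exchanging the absolutely convergent sums over \<open>n\<close> and
  over periodic paths produces the geometric series \<open>w ^ l / (1 - w ^ l)\<close>, and grouping the paths
  into shift orbits, that is, rotation classes of primitive closed paths, gives the zeta function.
  The shift by \<open>m\<close> between \<open>f\<close> and its one-sided reduction disappears in the sum over an orbit.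
\<close>

section \<open>Preimages under the shift\<close>

text \<open>Three obstacles shape the proof. Fibres of the shift over two points are matched, prefix
  by prefix, when the points share their first edge; otherwise the Lipschitz bound is paid for by
  the sup norm, at the largest possible distance \<theta>. This is why sup and Lipschitz bounds
  travel as a pair, and where the constant \<open>2 / \<theta>\<close> originates. Second, no
  spectral theory enters the trace: a diagonal matrix entry counts the preimages that return to a
  cylinder, and this count is exact at every positive cylinder length on which the multiplier is
  constant. The power zero admits no such count; its term vanishes for a separate reason. Third,
  zeta speaks of bi-infinite paths and of finite lists modulo rotation, the trace of one-sided
  sequences. A periodic path is determined by its right half, so the bookkeeping is done with
  one-sided periodic sequences and their minimal periods, into which lists and two-sided paths are
  translated.\<close>

lemma case_nat_mem_right_paths:
  "case_nat e p \<in> right_paths G \<longleftrightarrow> e \<in> parcs G \<and> follows e (p 0) \<and> p \<in> right_paths G"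
proof -
  have split_nat: "(\<forall>i. P i) \<longleftrightarrow> P 0 \<and> (\<forall>i. P (Suc i))" for P :: "nat \<Rightarrow> bool"
    by (metis nat.exhaust)
  show ?thesis
    unfolding right_paths_def mem_Collect_eq
    by (subst (1 2) split_nat) auto
qed

lemma right_paths_shift: "p \<in> right_paths G \<Longrightarrow> (\<lambda>i. p (i + n)) \<in> right_paths G"
  by (simp add: right_paths_def)

lemma right_paths_arc: "p \<in> right_paths G \<Longrightarrow> p i \<in> parcs G"
  by (simp add: right_paths_def)

lemma right_paths_follows: "p \<in> right_paths G \<Longrightarrow> follows (p i) (p (Suc i))"
  by (simp add: right_paths_def)

lemma map_upt_eq_iff: "map p [0..<k] = map p' [0..<k] \<longleftrightarrow> (\<forall>i<k. p i = p' i)"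
  by (auto simp: list_eq_iff_nth_eq)

lemma mem_cylinder_map_upt:
  "p' \<in> cylinder G (map p [0..<k]) \<longleftrightarrow> p' \<in> right_paths G \<and> (\<forall>i<k. p' i = p i)"
  by (auto simp: cylinder_def list_eq_iff_nth_eq)

lemma right_paths_splice:
  assumes "p \<in> right_paths G" "r \<in> right_paths G" "0 < n \<Longrightarrow> follows (p (n - 1)) (r 0)"
  shows "(\<lambda>i. if i < n then p i else r (i - n)) \<in> right_paths G"
proof -
  \<comment> \<open>The three cases are before, at and after the junction. Only the junction
    \<open>Suc i = n\<close> calls on the third assumption, whose guard \<open>0 < n\<close> keeps
    \<open>n - 1\<close> a genuine predecessor.\<close>
  have "follows (if i < n then p i else r (i - n)) (if Suc i < n then p (Suc i) else r (Suc i - n))" for i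
    using assms(3) right_paths_follows[OF assms(1), of i] right_paths_follows[OF assms(2), of "i - n"]
    by (cases "Suc i" n rule: linorder_cases) (auto simp: Suc_diff_le)
  then show ?thesis
    using right_paths_arc[OF assms(1)] right_paths_arc[OF assms(2)] by (simp add: right_paths_def)
qed

definition preimages ::
  "'v pair_pre_digraph \<Rightarrow> nat \<Rightarrow> (nat \<Rightarrow> 'v \<times> 'v) \<Rightarrow> (nat \<Rightarrow> 'v \<times> 'v) set" where
  "preimages G n p = {p' \<in> right_paths G. \<forall>i. p' (i + n) = p i}"

text \<open>Nonemptiness yields at least one path, so that the supremum in \<open>norm_theta\<close>
  is taken over a nonempty set.\<close>

locale regular_graph = pair_graph G for G :: "'v pair_pre_digraph" +
  fixes q :: nat
  assumes verts_nonempty: "pverts G \<noteq> {}"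
    and out_degree_eq: "v \<in> pverts G \<Longrightarrow> out_degree G v = q + 1"
    and q_gt_1: "q > 1"
begin

lemma swap_arc: "e \<in> parcs G \<Longrightarrow> prod.swap e \<in> parcs G"
  using arcs_symmetric by (cases e) auto

lemma card_out_arcs_minus:
  assumes "e \<in> parcs G"
  shows "card {b \<in> parcs G. fst b = fst e \<and> b \<noteq> e} = q"
proof -
  have "card (out_arcs G (fst e)) = q + 1"
    using out_degree_eq[OF arc_fst_in_verts[OF assms]] by (simp add: out_degree_def)
  moreover have "{b \<in> parcs G. fst b = fst e \<and> b \<noteq> e} = out_arcs G (fst e) - {e}"
    by (auto simp: out_arcs_def)
  ultimately show ?thesis
    using assms by (simp add: out_arcs_def)
qed

text \<open>The edges leaving the head of \<open>a\<close> are those that share the initial vertex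
  of its reversal, and the forbidden backtracking edge is that reversal itself.\<close>

lemma card_followers:
  assumes "a \<in> parcs G"
  shows "card {b \<in> parcs G. follows a b} = q"
  using card_out_arcs_minus[OF swap_arc[OF assms]] by (simp add: follows_def eq_commute[of "snd a"])

text \<open>Reversal carries the predecessors of \<open>b\<close> to the edges leaving
  \<open>fst b\<close> other than \<open>b\<close>, so the out-degree also controls the number of
  preimages.\<close>

lemma card_preceding:
  assumes "b \<in> parcs G"
  shows "card {a \<in> parcs G. follows a b} = q"
proof -
  have "prod.swap a \<in> parcs G \<and> fst (prod.swap a) = fst b \<and> prod.swap a \<noteq> b"
    if "a \<in> parcs G" "follows a b" for a
    using that swap_arc by (metis follows_def fst_swap)
  moreover have "prod.swap a \<in> parcs G \<and> follows (prod.swap a) b"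
    if "a \<in> parcs G" "fst a = fst b" "a \<noteq> b" for a
    using that swap_arc by (metis follows_def snd_swap swap_swap)
  ultimately have "bij_betw prod.swap {a \<in> parcs G. follows a b} {a \<in> parcs G. fst a = fst b \<and> a \<noteq> b}"
    by (intro bij_betw_byWitness[where f' = prod.swap])
      (simp_all only: image_subset_iff swap_swap mem_Collect_eq ball_simps, blast+)
  from bij_betw_same_card[OF this] show ?thesis
    using card_out_arcs_minus[OF assms] by simp
qed

section \<open>Fibres of the shift and powers of the transfer operator\<close>

lemma preimages_0: "p \<in> right_paths G \<Longrightarrow> preimages G 0 p = {p}"
  by (auto simp: preimages_def)

lemma preimages_subset: "preimages G n p \<subseteq> right_paths G"
  by (auto simp: preimages_def)

lemma preimages_Suc_0:
  assumes "p \<in> right_paths G"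
  shows "preimages G (Suc 0) p = (\<lambda>e. case_nat e p) ` {e \<in> parcs G. follows e (p 0)}"
proof -
  have "p' \<in> (\<lambda>e. case_nat e p) ` {e \<in> parcs G. follows e (p 0)}"
    if "p' \<in> preimages G (Suc 0) p" for p'
  proof (rule image_eqI[where x = "p' 0"])
    show "p' = case_nat (p' 0) p"
      using that by (auto simp: preimages_def fun_eq_iff split: nat.splits)
    show "p' 0 \<in> {e \<in> parcs G. follows e (p 0)}"
      using that right_paths_follows[of p' G 0] right_paths_arc[of p' G 0]
      by (auto simp: preimages_def)
  qed
  then show ?thesis
    using assms by (auto simp: preimages_def case_nat_mem_right_paths)
qed

lemma inj_case_nat: "inj_on (\<lambda>e. case_nat e p) A"
  by (rule inj_onI) (auto dest: fun_cong[where x = 0])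

lemma card_preimages_Suc_0: "p \<in> right_paths G \<Longrightarrow> card (preimages G (Suc 0) p) = q"
  by (simp add: preimages_Suc_0 card_image[OF inj_case_nat] card_preceding right_paths_arc)

lemma finite_preimages_Suc_0: "p \<in> right_paths G \<Longrightarrow> finite (preimages G (Suc 0) p)"
  by (simp add: preimages_Suc_0)

text \<open>Each path in the fibre is grouped by its own one-step shift; counting and summation over
  fibres can then proceed one step at a time.\<close>

lemma preimages_Suc: "preimages G (Suc n) p = (\<Union>r\<in>preimages G n p. preimages G (Suc 0) r)"
proof (intro subset_antisym subsetI)
  fix p' assume p': "p' \<in> preimages G (Suc n) p"
  then have "(\<lambda>i. p' (i + 1)) \<in> preimages G n p"
    using right_paths_shift[of p' G 1] by (auto simp: preimages_def)
  moreover have "p' \<in> preimages G (Suc 0) (\<lambda>i. p' (i + 1))"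
    using p' by (auto simp: preimages_def)
  ultimately show "p' \<in> (\<Union>r\<in>preimages G n p. preimages G (Suc 0) r)"
    by blast
next
  fix p' assume "p' \<in> (\<Union>r\<in>preimages G n p. preimages G (Suc 0) r)"
  then show "p' \<in> preimages G (Suc n) p"
    by (auto simp: preimages_def)
qed

lemma preimages_disjoint: "r \<noteq> r' \<Longrightarrow> preimages G n r \<inter> preimages G n r' = {}"
  by (auto simp: preimages_def fun_eq_iff)

lemma finite_preimages: "p \<in> right_paths G \<Longrightarrow> finite (preimages G n p)"
proof (induction n)
  case (Suc n)
  then show ?case
    unfolding preimages_Suc[of n] by (auto intro!: finite_preimages_Suc_0 dest: subsetD[OF preimages_subset])
qed (simp add: preimages_0)

lemma sum_preimages_Suc:
  assumes "p \<in> right_paths G"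
  shows "sum \<phi> (preimages G (Suc n) p) = (\<Sum>r\<in>preimages G n p. sum \<phi> (preimages G (Suc 0) r))"
  unfolding preimages_Suc[of n]
  by (rule sum.UNION_disjoint[OF finite_preimages[OF assms]])
    (auto intro!: finite_preimages_Suc_0 preimages_disjoint dest: subsetD[OF preimages_subset])

lemma card_preimages:
  assumes "p \<in> right_paths G"
  shows "card (preimages G n p) = q ^ n"
proof (induction n)
  case (Suc n)
  have "card (preimages G (Suc n) p) = (\<Sum>r\<in>preimages G n p. card (preimages G (Suc 0) r))"
    using sum_preimages_Suc[OF assms, of "\<lambda>_. 1 :: nat"] by simp
  also have "\<dots> = (\<Sum>r\<in>preimages G n p. q)"
    by (rule sum.cong) (auto intro!: card_preimages_Suc_0 dest: subsetD[OF preimages_subset])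
  finally show ?case
    using Suc by simp
qed (use assms in \<open>simp add: preimages_0\<close>)

lemma transfer_op_eq:
  assumes "p \<in> right_paths G"
  shows "transfer_op G \<phi> p = sum \<phi> (preimages G (Suc 0) p)"
proof -
  have "{p' \<in> right_paths G. right_shift p' = p} = preimages G (Suc 0) p"
    by (auto simp: preimages_def right_shift_def)
  then show ?thesis
    using assms by (simp add: transfer_op_def)
qed

lemma transfer_op_funpow:
  assumes "p \<in> right_paths G"
  shows "(transfer_op G ^^ n) \<phi> p = sum \<phi> (preimages G n p)"
proof (induction n arbitrary: \<phi>)
  case 0
  then show ?case using assms by (simp add: preimages_0)
next
  case (Suc n)
  \<comment> \<open>The innermost application is peeled off, so the induction hypothesis is used for
    the function \<open>transfer_op G \<phi>\<close>; hence the generalisation over \<phi>.\<close>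
  have "(transfer_op G ^^ Suc n) \<phi> p = (transfer_op G ^^ n) (transfer_op G \<phi>) p"
    by (simp add: funpow_swap1)
  also have "\<dots> = (\<Sum>r\<in>preimages G n p. sum \<phi> (preimages G (Suc 0) r))"
    unfolding Suc by (rule sum.cong) (auto intro!: transfer_op_eq dest: subsetD[OF preimages_subset])
  finally show ?case
    by (simp add: sum_preimages_Suc[OF assms])
qed

lemma transfer_op_funpow_outside:
  "(\<And>p. p \<notin> right_paths G \<Longrightarrow> \<phi> p = 0) \<Longrightarrow> p \<notin> right_paths G \<Longrightarrow> (transfer_op G ^^ n) \<phi> p = 0"
  by (cases n) (simp_all add: transfer_op_def)

text \<open>Whether a prefix of length \<open>n\<close> can be put in front of \<open>p\<close>
  depends on \<open>p 0\<close> alone. Keeping the prefix and exchanging the tail therefore matches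
  the two fibres, and matched paths disagree only from index \<open>n\<close> on.\<close>

lemma bij_betw_preimages:
  assumes "p \<in> right_paths G" "p' \<in> right_paths G" "p 0 = p' 0"
  shows "bij_betw (\<lambda>r i. if i < n then r i else p' (i - n)) (preimages G n p) (preimages G n p')"
proof -
  have *: "(\<lambda>i. if i < n then r i else p' (i - n)) \<in> preimages G n p'"
    if r: "r \<in> preimages G n p" and p: "p' \<in> right_paths G" "p 0 = p' 0" for r p p'
  proof -
    have "r n = p' 0"
      using r p by (auto simp: preimages_def dest: spec[where x = 0])
    then have "follows (r (n - 1)) (p' 0)" if "0 < n"
      using r right_paths_follows[of r G "n - 1"] that by (simp add: preimages_def)
    then show ?thesis
      using r p right_paths_splice[of r G p' n] by (simp add: preimages_def)
  qed
  show ?thesis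
  proof (rule bij_betw_byWitness[where f' = "\<lambda>r i. if i < n then r i else p (i - n)"])
    have ret: "(\<lambda>i. if i < n then (if i < n then r i else p' (i - n)) else p (i - n)) = r"
      if "r \<in> preimages G n p" for r p p'
    proof
      fix i show "(if i < n then (if i < n then r i else p' (i - n)) else p (i - n)) = r i"
        using that by (auto simp: preimages_def dest: spec[where x = "i - n"])
    qed
    show "\<forall>r\<in>preimages G n p. (\<lambda>i. if i < n then (if i < n then r i else p' (i - n)) else p (i - n)) = r"
      "\<forall>r\<in>preimages G n p'. (\<lambda>i. if i < n then (if i < n then r i else p (i - n)) else p' (i - n)) = r"
      using ret by blast+
  qed (use assms * in auto)
qed

lemma follower_exists: "a \<in> parcs G \<Longrightarrow> \<exists>b\<in>parcs G. follows a b"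
  using card_followers[of a] q_gt_1 by (metis (no_types, lifting) card.empty empty_Collect_eq not_one_less_zero)

lemma right_path_exists:
  assumes "a \<in> parcs G"
  obtains p where "p \<in> right_paths G" "p 0 = a"
proof -
  have "\<exists>p. \<forall>n. (p n \<in> parcs G \<and> (n = 0 \<longrightarrow> p n = a)) \<and> follows (p n) (p (Suc n))"
    by (rule dependent_nat_choice) (use assms follower_exists in blast)+
  then show thesis
    using that by (auto simp: right_paths_def)
qed

lemma right_paths_nonempty: "right_paths G \<noteq> {}"
proof -
  obtain v where "v \<in> pverts G" using verts_nonempty by blast
  then have "out_arcs G v \<noteq> {}"
    using out_degree_eq[of v] by (auto simp: out_degree_def)
  then obtain e where "e \<in> parcs G"
    by (auto simp: out_arcs_def)
  then show ?thesis
    using right_path_exists by blast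
qed

lemma finite_words: "finite (words G k)"
proof (rule finite_subset)
  show "words G k \<subseteq> {xs. set xs \<subseteq> parcs G \<and> length xs = k}"
    by (auto simp: words_def right_paths_arc)
  show "finite {xs. set xs \<subseteq> parcs G \<and> length xs = k}"
    by (rule finite_lists_length_eq) simp
qed

end

section \<open>Lipschitz estimates and the Neumann series\<close>

lemma d_theta_nonneg: "0 < \<theta> \<Longrightarrow> 0 \<le> d_theta \<theta> p p'"
  by (simp add: d_theta_def)

lemma d_theta_pos: "0 < \<theta> \<Longrightarrow> p \<noteq> p' \<Longrightarrow> 0 < d_theta \<theta> p p'"
  by (simp add: d_theta_def)

lemma d_theta_le_1: "0 < \<theta> \<Longrightarrow> \<theta> < 1 \<Longrightarrow> d_theta \<theta> p p' \<le> 1"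
  by (simp add: d_theta_def power_le_one del: power_Suc)

lemma d_theta_first:
  assumes "p 0 \<noteq> p' 0"
  shows "d_theta \<theta> p p' = \<theta>"
proof -
  have "(LEAST i. p i \<noteq> p' i) = 0"
    using assms by (simp add: Least_eq_0)
  then show ?thesis
    using assms by (auto simp: d_theta_def)
qed

text \<open>The distance is a power of \<theta> < 1 whose exponent is the first disagreement: if
  \<open>p\<close> and \<open>p'\<close> disagree no later than \<open>r\<close> and
  \<open>r'\<close> do, they are at least as far apart.\<close>

lemma d_theta_mono:
  assumes "0 < \<theta>" "\<theta> < 1" "\<And>i. r i \<noteq> r' i \<Longrightarrow> \<exists>j\<le>i. p j \<noteq> p' j"
  shows "d_theta \<theta> r r' \<le> d_theta \<theta> p p'"
proof (cases "r = r'")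
  case True
  then show ?thesis
    using d_theta_nonneg assms by (simp add: d_theta_def)
next
  case False
  define i where "i = (LEAST i. r i \<noteq> r' i)"
  have "\<exists>i. r i \<noteq> r' i"
    using False by blast
  then have "r i \<noteq> r' i"
    unfolding i_def by (rule LeastI_ex)
  from assms(3)[OF this] obtain j where j: "j \<le> i" "p j \<noteq> p' j"
    by blast
  have "(LEAST i. p i \<noteq> p' i) \<le> j"
    by (rule Least_le) (rule j)
  then have "\<theta> ^ Suc i \<le> \<theta> ^ Suc (LEAST i. p i \<noteq> p' i)"
    using j assms by (intro power_decreasing) auto
  moreover have "p \<noteq> p'"
    using j by blast
  ultimately show ?thesis
    using False by (simp only: d_theta_def i_def if_False)
qed

lemma d_theta_ge:
  assumes "0 < \<theta>" "\<theta> < 1" "i < k" "p i \<noteq> p' i"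
  shows "\<theta> ^ k \<le> d_theta \<theta> p p'"
proof -
  have "Suc (LEAST i. p i \<noteq> p' i) \<le> k"
    using Least_le[of "\<lambda>i. p i \<noteq> p' i" i] assms by simp
  then show ?thesis
    using assms by (auto simp: d_theta_def simp del: power_Suc intro!: power_decreasing)
qed

text \<open>Sup bound and Lipschitz constant are kept apart because the transfer operator feeds the
  first into the second. Explicit bounds also avoid the infimum and supremum of
  \<open>norm_theta\<close>, which are reached through \<open>norm_theta_le\<close> and
  \<open>F_theta_lip_est\<close>.\<close>

definition lip_est ::
  "'v pair_pre_digraph \<Rightarrow> real \<Rightarrow> real \<Rightarrow> real \<Rightarrow> ((nat \<Rightarrow> 'v \<times> 'v) \<Rightarrow> complex) \<Rightarrow> bool" where
  "lip_est G \<theta> A B \<phi> \<longleftrightarrow> 0 \<le> A \<and> 0 \<le> B \<and>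
     (\<forall>p\<in>right_paths G. cmod (\<phi> p) \<le> A) \<and>
     (\<forall>p\<in>right_paths G. \<forall>p'\<in>right_paths G. cmod (\<phi> p - \<phi> p') \<le> B * d_theta \<theta> p p') \<and>
     (\<forall>p. p \<notin> right_paths G \<longrightarrow> \<phi> p = 0)"

lemma lip_est_F_theta: "lip_est G \<theta> A B \<phi> \<Longrightarrow> \<phi> \<in> F_theta G \<theta>"
  by (auto simp: lip_est_def F_theta_def lip_bounds_def)

text \<open>This replaces a completeness argument for \<open>F_theta\<close>: the limit is the
  pointwise sum, and a common majorant \<open>c\<close> of the terms bounds both its size and its
  differences.\<close>

lemma lip_est_suminf:
  assumes est: "\<And>n. lip_est G \<theta> (c n * A) (c n * B) (g n)" and "summable c" "\<And>n. 0 \<le> c n"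
    and \<theta>: "0 < \<theta>" and AB: "0 \<le> A" "0 \<le> B"
  shows "lip_est G \<theta> (suminf c * A) (suminf c * B) (\<lambda>p. \<Sum>n. g n p)"
  unfolding lip_est_def
proof (intro conjI ballI allI impI)
  have sA: "summable (\<lambda>n. c n * A)" for A :: real
    using assms(2) by (rule summable_mult2)
  have sg: "summable (\<lambda>n. norm (g n p))" if "p \<in> right_paths G" for p
    by (rule summable_comparison_test'[OF sA[of A]]) (use est that in \<open>auto simp: lip_est_def\<close>)
  have c0: "0 \<le> suminf c"
    using assms by (intro suminf_nonneg) auto
  show "0 \<le> suminf c * A" "0 \<le> suminf c * B"
    using c0 AB by auto
  show "cmod (\<Sum>n. g n p) \<le> suminf c * A" if "p \<in> right_paths G" for p
  proof -
    have "cmod (\<Sum>n. g n p) \<le> (\<Sum>n. norm (g n p))"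
      by (rule summable_norm[OF sg[OF that]])
    also have "\<dots> \<le> (\<Sum>n. c n * A)"
      by (rule suminf_le[OF _ sg[OF that] sA]) (use est that in \<open>auto simp: lip_est_def\<close>)
    finally show ?thesis
      using suminf_mult2[OF assms(2)] by simp
  qed
  show "cmod ((\<Sum>n. g n p) - (\<Sum>n. g n p')) \<le> suminf c * B * d_theta \<theta> p p'"
    if p: "p \<in> right_paths G" and p': "p' \<in> right_paths G" for p p'
  proof -
    let ?D = "B * d_theta \<theta> p p'"
    have le: "norm (g n p - g n p') \<le> c n * ?D" for n
      using est[of n] p p' by (auto simp: lip_est_def mult.assoc)
    have sd: "summable (\<lambda>n. norm (g n p - g n p'))"
      by (rule summable_comparison_test'[OF sA[of ?D]]) (use le in simp)
    have "(\<Sum>n. g n p) - (\<Sum>n. g n p') = (\<Sum>n. g n p - g n p')"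
      by (rule suminf_diff[OF summable_norm_cancel[OF sg[OF p]] summable_norm_cancel[OF sg[OF p']]])
    also have "cmod \<dots> \<le> (\<Sum>n. norm (g n p - g n p'))"
      by (rule summable_norm[OF sd])
    also have "\<dots> \<le> (\<Sum>n. c n * ?D)"
      by (rule suminf_le[OF le sd sA])
    finally show ?thesis
      unfolding suminf_mult2[OF assms(2), symmetric] by (simp only: mult.assoc)
  qed
  show "(\<Sum>n. g n p) = 0" if "p \<notin> right_paths G" for p
    using est that by (simp add: lip_est_def)
qed

lemma lip_est_scale:
  "lip_est G \<theta> A B \<phi> \<Longrightarrow> lip_est G \<theta> (cmod c * A) (cmod c * B) (\<lambda>p. c * \<phi> p)"
  by (auto simp: lip_est_def norm_mult mult.assoc mult_left_mono simp flip: right_diff_distrib)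

lemma lip_est_uminus: "lip_est G \<theta> A B \<phi> \<Longrightarrow> lip_est G \<theta> A B (\<lambda>p. - \<phi> p)"
  using lip_est_scale[of G \<theta> A B \<phi> "-1"] by simp

lemma lip_est_diff:
  assumes "lip_est G \<theta> A B \<phi>" "lip_est G \<theta> A' B' \<psi>"
  shows "lip_est G \<theta> (A + A') (B + B') (\<lambda>p. \<phi> p - \<psi> p)"
  unfolding lip_est_def
proof (intro conjI ballI allI impI)
  show "cmod (\<phi> p - \<psi> p) \<le> A + A'" if "p \<in> right_paths G" for p
    using assms that norm_triangle_ineq4[of "\<phi> p" "\<psi> p"] by (fastforce simp: lip_est_def)
  show "cmod (\<phi> p - \<psi> p - (\<phi> p' - \<psi> p')) \<le> (B + B') * d_theta \<theta> p p'"
    if "p \<in> right_paths G" "p' \<in> right_paths G" for p p'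
  proof -
    have "cmod (\<phi> p - \<phi> p') \<le> B * d_theta \<theta> p p'" "cmod (\<psi> p - \<psi> p') \<le> B' * d_theta \<theta> p p'"
      using assms that by (auto simp: lip_est_def)
    moreover have eq: "\<phi> p - \<psi> p - (\<phi> p' - \<psi> p') = \<phi> p - \<phi> p' - (\<psi> p - \<psi> p')"
      by simp
    ultimately show ?thesis
      using norm_triangle_ineq4[of "\<phi> p - \<phi> p'" "\<psi> p - \<psi> p'"]
      unfolding distrib_right eq by linarith
  qed
qed (use assms in \<open>auto simp: lip_est_def\<close>)

lemma lip_est_mult:
  assumes "lip_est G \<theta> A B \<phi>" "lip_est G \<theta> A' B' \<psi>" "0 < \<theta>"
  shows "lip_est G \<theta> (A * A') (A * B' + A' * B) (\<lambda>p. \<phi> p * \<psi> p)"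
  unfolding lip_est_def
proof (intro conjI ballI allI impI)
  show "cmod (\<phi> p * \<psi> p) \<le> A * A'" if "p \<in> right_paths G" for p
    using assms that by (auto simp: lip_est_def norm_mult intro!: mult_mono)
  show "cmod (\<phi> p * \<psi> p - \<phi> p' * \<psi> p') \<le> (A * B' + A' * B) * d_theta \<theta> p p'"
    if p: "p \<in> right_paths G" "p' \<in> right_paths G" for p p'
  proof -
    have "\<phi> p * \<psi> p - \<phi> p' * \<psi> p' = \<phi> p * (\<psi> p - \<psi> p') + \<psi> p' * (\<phi> p - \<phi> p')"
      by (simp add: algebra_simps)
    also have "cmod \<dots> \<le> cmod (\<phi> p) * cmod (\<psi> p - \<psi> p') + cmod (\<psi> p') * cmod (\<phi> p - \<phi> p')"
      by (metis norm_triangle_ineq norm_mult)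
    also have "\<dots> \<le> A * (B' * d_theta \<theta> p p') + A' * (B * d_theta \<theta> p p')"
      using assms p by (intro add_mono mult_mono) (auto simp: lip_est_def)
    finally show ?thesis
      by (simp add: algebra_simps)
  qed
qed (use assms in \<open>auto simp: lip_est_def\<close>)

text \<open>Two points at which \<phi> differs already disagree among the first \<open>k\<close>
  edges, so they are at distance at least \<open>\<theta> ^ k\<close>, and boundedness does the
  rest.\<close>

lemma F_fin_F_theta:
  assumes "\<phi> \<in> F_fin G k" "0 < \<theta>" "\<theta> < 1" "\<And>p. p \<in> right_paths G \<Longrightarrow> cmod (\<phi> p) \<le> M"
  shows "\<phi> \<in> F_theta G \<theta>"
proof -
  \<comment> \<open>The oscillation is at most \<open>2 * \<bar>M\<bar>\<close>, and division by
    \<open>\<theta> ^ k\<close> absorbs the smallest relevant distance. The absolute value keeps the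
    constant nonnegative even if there are no paths to force \<open>M\<close> to be so.\<close>
  have "cmod (\<phi> p - \<phi> p') \<le> (2 * \<bar>M\<bar> / \<theta> ^ k) * d_theta \<theta> p p'"
    if p: "p \<in> right_paths G" "p' \<in> right_paths G" for p p'
  proof (cases "\<forall>i<k. p i = p' i")
    case True
    then have "\<phi> p = \<phi> p'"
      using assms(1) p unfolding F_fin_def by blast
    then show ?thesis
      using assms d_theta_nonneg[of \<theta> p p'] by simp
  next
    case False
    then have "\<theta> ^ k \<le> d_theta \<theta> p p'"
      using d_theta_ge assms by blast
    then have "2 * \<bar>M\<bar> * \<theta> ^ k \<le> 2 * \<bar>M\<bar> * d_theta \<theta> p p'"
      by (intro mult_left_mono) auto
    then have "2 * \<bar>M\<bar> \<le> (2 * \<bar>M\<bar> / \<theta> ^ k) * d_theta \<theta> p p'"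
      using assms by (simp add: field_simps)
    moreover have "cmod (\<phi> p - \<phi> p') \<le> 2 * \<bar>M\<bar>"
      using assms(4)[OF p(1)] assms(4)[OF p(2)] norm_triangle_ineq4[of "\<phi> p" "\<phi> p'"] by linarith
    ultimately show ?thesis by linarith
  qed
  moreover have "0 \<le> 2 * \<bar>M\<bar> / \<theta> ^ k"
    using assms by simp
  ultimately have "2 * \<bar>M\<bar> / \<theta> ^ k \<in> lip_bounds G \<theta> \<phi>"
    by (auto simp: lip_bounds_def)
  then show ?thesis
    using assms(1) by (auto simp: F_theta_def F_fin_def)
qed

context regular_graph
begin

lemma norm_theta_le:
  assumes "lip_est G \<theta> A B \<phi>"
  shows "norm_theta G \<theta> \<phi> \<le> A + B"
proof -
  have "Inf (lip_bounds G \<theta> \<phi>) \<le> B"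
    by (rule cInf_lower) (use assms in \<open>auto simp: lip_est_def lip_bounds_def intro!: bdd_belowI[where m = 0]\<close>)
  moreover have "(SUP p\<in>right_paths G. cmod (\<phi> p)) \<le> A"
    by (rule cSUP_least) (use assms right_paths_nonempty in \<open>auto simp: lip_est_def\<close>)
  ultimately show ?thesis
    by (simp add: norm_theta_def)
qed

text \<open>Both parts of the norm are attained as bounds. The supremum is finite because distances
  are at most 1, so a Lipschitz function is bounded around any base point; the infimum is itself a
  Lipschitz constant because the inequality can be divided by a positive distance.\<close>

lemma F_theta_lip_est:
  assumes "\<phi> \<in> F_theta G \<theta>" "0 < \<theta>" "\<theta> < 1"
  obtains A B where "lip_est G \<theta> A B \<phi>" "norm_theta G \<theta> \<phi> = A + B"
proof
  obtain C where C: "C \<in> lip_bounds G \<theta> \<phi>"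
    using assms by (auto simp: F_theta_def)
  obtain p0 where p0: "p0 \<in> right_paths G"
    using right_paths_nonempty by blast
  have "cmod (\<phi> p) \<le> cmod (\<phi> p0) + C" if "p \<in> right_paths G" for p
  proof -
    have "cmod (\<phi> p - \<phi> p0) \<le> C * d_theta \<theta> p p0" "0 \<le> C"
      using C that p0 by (auto simp: lip_bounds_def)
    moreover have "C * d_theta \<theta> p p0 \<le> C"
      using d_theta_le_1[of \<theta> p p0] assms \<open>0 \<le> C\<close> by (simp add: mult_left_le)
    ultimately show ?thesis
      using norm_triangle_ineq2[of "\<phi> p" "\<phi> p0"] by linarith
  qed
  then have bdd: "bdd_above ((\<lambda>p. cmod (\<phi> p)) ` right_paths G)"
    by (meson bdd_aboveI2)
  let ?A = "SUP p\<in>right_paths G. cmod (\<phi> p)" and ?B = "Inf (lip_bounds G \<theta> \<phi>)"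
  have A: "cmod (\<phi> p) \<le> ?A" if "p \<in> right_paths G" for p
    using bdd that by (rule cSUP_upper2) simp
  have "0 \<le> ?B"
    using C by (intro cInf_greatest) (auto simp: lip_bounds_def)
  moreover have "0 \<le> ?A"
    using A[OF p0] norm_ge_zero order_trans by blast
  moreover have "cmod (\<phi> p - \<phi> p') \<le> ?B * d_theta \<theta> p p'"
    if p: "p \<in> right_paths G" "p' \<in> right_paths G" for p p'
  proof (cases "p = p'")
    case False
    have "cmod (\<phi> p - \<phi> p') / d_theta \<theta> p p' \<le> ?B"
    proof (rule cInf_greatest)
      fix c assume "c \<in> lip_bounds G \<theta> \<phi>"
      then have "cmod (\<phi> p - \<phi> p') \<le> c * d_theta \<theta> p p'"
        using p by (auto simp: lip_bounds_def)
      then show "cmod (\<phi> p - \<phi> p') / d_theta \<theta> p p' \<le> c"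
        using d_theta_pos[OF assms(2) False] by (simp add: divide_le_eq)
    qed (use C in auto)
    then show ?thesis
      using d_theta_pos[OF assms(2) False] by (simp add: divide_le_eq)
  qed (simp add: d_theta_def)
  ultimately show "lip_est G \<theta> ?A ?B \<phi>"
    using A assms(1) by (auto simp: lip_est_def F_theta_def)
  show "norm_theta G \<theta> \<phi> = ?A + ?B"
    by (simp add: norm_theta_def)
qed

text \<open>With equal first edges the \<open>q ^ n\<close> matched preimages contribute at most
  \<open>B\<close> times the distance each. With different first edges the distance is \<theta>, and
  twice the sup bound is written as \<open>2 / \<theta> * A\<close> times that distance. Apart from
  \<open>q ^ n\<close> the constants are independent of \<open>n\<close>, as the geometric majorant
  requires.\<close>

lemma lip_est_transfer_op_funpow:
  assumes est: "lip_est G \<theta> A B \<phi>" and \<theta>: "0 < \<theta>" "\<theta> < 1"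
  shows "lip_est G \<theta> (real q ^ n * A) (real q ^ n * (B + 2 / \<theta> * A)) ((transfer_op G ^^ n) \<phi>)"
  unfolding lip_est_def
proof (intro conjI ballI allI impI)
  have AB: "0 \<le> A" "0 \<le> B"
    using est by (auto simp: lip_est_def)
  then show "0 \<le> real q ^ n * A" "0 \<le> real q ^ n * (B + 2 / \<theta> * A)"
    using \<theta> by auto
  show le: "cmod ((transfer_op G ^^ n) \<phi> p) \<le> real q ^ n * A" if p: "p \<in> right_paths G" for p
  proof -
    have "cmod (sum \<phi> (preimages G n p)) \<le> card (preimages G n p) * A"
      by (rule sum_norm_bound) (use est preimages_subset in \<open>auto simp: lip_est_def\<close>)
    then show ?thesis
      by (simp add: transfer_op_funpow[OF p] card_preimages[OF p])
  qed
  show "cmod ((transfer_op G ^^ n) \<phi> p - (transfer_op G ^^ n) \<phi> p')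
      \<le> real q ^ n * (B + 2 / \<theta> * A) * d_theta \<theta> p p'"
    if p: "p \<in> right_paths G" "p' \<in> right_paths G" for p p'
  proof (cases "p 0 = p' 0")
    case True
    let ?h = "\<lambda>r i. if i < n then r i else p' (i - n)"
    have bij: "bij_betw ?h (preimages G n p) (preimages G n p')"
      by (rule bij_betw_preimages[OF p True])
    have "sum \<phi> (preimages G n p) - sum \<phi> (preimages G n p') =
        (\<Sum>r\<in>preimages G n p. \<phi> r - \<phi> (?h r))"
      using sum.reindex_bij_betw[OF bij, of \<phi>] by (simp add: sum_subtractf)
    also have "cmod \<dots> \<le> card (preimages G n p) * (B * d_theta \<theta> p p')"
    proof (rule sum_norm_bound)
      fix r assume r: "r \<in> preimages G n p"
      have rr: "r \<in> right_paths G" "?h r \<in> right_paths G"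
        using r bij_betwE[OF bij] preimages_subset by blast+
      \<comment> \<open>A disagreement of the matched preimages at \<open>i\<close> lies beyond the
        common prefix and comes from one of \<open>p\<close> and \<open>p'\<close> at
        \<open>i - n\<close>.\<close>
      have "d_theta \<theta> r (?h r) \<le> d_theta \<theta> p p'"
      proof (rule d_theta_mono[OF \<theta>])
        fix i assume i: "r i \<noteq> ?h r i"
        then have "n \<le> i"
          by (metis linorder_not_le)
        then have "r i = p (i - n)"
          using r by (auto simp: preimages_def dest: spec[where x = "i - n"])
        with i \<open>n \<le> i\<close> show "\<exists>j\<le>i. p j \<noteq> p' j"
          by (intro exI[where x = "i - n"]) auto
      qed
      then have "B * d_theta \<theta> r (?h r) \<le> B * d_theta \<theta> p p'"
        using AB(2) by (rule mult_left_mono)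
      then show "cmod (\<phi> r - \<phi> (?h r)) \<le> B * d_theta \<theta> p p'"
        using est rr unfolding lip_est_def by (meson order_trans)
    qed
    also have "\<dots> \<le> real q ^ n * (B + 2 / \<theta> * A) * d_theta \<theta> p p'"
      using AB \<theta> d_theta_nonneg[OF \<theta>(1), of p p']
      by (simp add: card_preimages[OF p(1)] mult.assoc mult_left_mono mult_right_mono)
    finally show ?thesis
      by (simp add: transfer_op_funpow p)
  next
    case False
    \<comment> \<open>The paths have the maximal distance \<open>\<theta>\<close>, so the sup bound is already a Lipschitz bound.\<close>
    have "cmod ((transfer_op G ^^ n) \<phi> p - (transfer_op G ^^ n) \<phi> p') \<le> 2 * (real q ^ n * A)"
      using le[OF p(1)] le[OF p(2)] norm_triangle_ineq4 by (smt (verit))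
    also have "\<dots> = real q ^ n * (2 / \<theta> * A) * d_theta \<theta> p p'"
      using \<theta> d_theta_first[of p p' \<theta>] False by simp
    also have "\<dots> \<le> real q ^ n * (B + 2 / \<theta> * A) * d_theta \<theta> p p'"
      using AB d_theta_nonneg[OF \<theta>(1), of p p'] by (intro mult_right_mono mult_left_mono) auto
    finally show ?thesis .
  qed
  show "(transfer_op G ^^ n) \<phi> p = 0" if "p \<notin> right_paths G" for p
    using est that by (intro transfer_op_funpow_outside) (auto simp: lip_est_def)
qed

section \<open>The Neumann series and its tails\<close>

lemma transfer_op_funpow_diff_scale:
  assumes "p \<in> right_paths G"
  shows "(transfer_op G ^^ n) (\<lambda>p. \<phi> p - c * \<psi> p) p =
    (transfer_op G ^^ n) \<phi> p - c * (transfer_op G ^^ n) \<psi> p"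
  using assms by (simp add: transfer_op_funpow sum_subtractf sum_distrib_left)

lemma lip_est_scaled_transfer_op_funpow:
  assumes "lip_est G \<theta> A B \<phi>" "0 < \<theta>" "\<theta> < 1"
  shows "lip_est G \<theta> ((cmod w * q) ^ n * A) ((cmod w * q) ^ n * (B + 2 / \<theta> * A))
    (\<lambda>p. w ^ n * (transfer_op G ^^ n) \<phi> p)"
  using lip_est_scale[OF lip_est_transfer_op_funpow[OF assms, of n], of "w ^ n"]
  by (simp add: norm_power power_mult_distrib mult.assoc)

text \<open>For \<open>N = 0\<close> this is the full series, the candidate for the resolvent; for
  general \<open>N\<close> it is the error of the partial sum. One estimate thus gives both
  boundedness and convergence in operator norm.\<close>

definition neumann_tail :: "complex \<Rightarrow> nat \<Rightarrow> 'v path_op" where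
  "neumann_tail w N \<phi> = (\<lambda>p. \<Sum>n. w ^ (n + N) * (transfer_op G ^^ (n + N)) \<phi> p)"

context
  fixes w :: complex and \<theta> :: real
  assumes w: "cmod w * q < 1" and \<theta>: "0 < \<theta>" "\<theta> < 1"
begin

lemma lip_est_neumann_tail:
  assumes "lip_est G \<theta> A B \<phi>"
  shows "lip_est G \<theta> ((cmod w * q) ^ N / (1 - cmod w * q) * A)
    ((cmod w * q) ^ N / (1 - cmod w * q) * (B + 2 / \<theta> * A)) (neumann_tail w N \<phi>)"
proof -
  let ?r = "cmod w * q"
  have "(\<lambda>n. ?r ^ N * ?r ^ n) sums (?r ^ N * (1 / (1 - ?r)))"
    using w by (intro sums_mult geometric_sums) simp
  then have sums: "(\<lambda>n. ?r ^ (n + N)) sums (?r ^ N / (1 - ?r))"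
    by (simp add: power_add mult.commute)
  have "lip_est G \<theta> (suminf (\<lambda>n. ?r ^ (n + N)) * A) (suminf (\<lambda>n. ?r ^ (n + N)) * (B + 2 / \<theta> * A))
    (\<lambda>p. \<Sum>n. w ^ (n + N) * (transfer_op G ^^ (n + N)) \<phi> p)"
  proof (rule lip_est_suminf)
    show "lip_est G \<theta> (?r ^ (n + N) * A) (?r ^ (n + N) * (B + 2 / \<theta> * A))
        (\<lambda>p. w ^ (n + N) * (transfer_op G ^^ (n + N)) \<phi> p)" for n
      by (rule lip_est_scaled_transfer_op_funpow[OF assms \<theta>])
    show "0 \<le> A" "0 \<le> B + 2 / \<theta> * A"
      using assms \<theta> by (auto simp: lip_est_def)
  qed (use sums \<theta> in \<open>auto simp: sums_iff\<close>)
  then show ?thesis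
    unfolding neumann_tail_def sums_unique[OF sums, symmetric] .
qed

lemma neumann_tail_F_theta: "\<phi> \<in> F_theta G \<theta> \<Longrightarrow> neumann_tail w N \<phi> \<in> F_theta G \<theta>"
  using F_theta_lip_est[OF _ \<theta>] lip_est_neumann_tail lip_est_F_theta by metis

text \<open>The factor \<open>1 + 2 / \<theta>\<close> accounts for the sup bound that leaks into
  the Lipschitz constant; the rest is the tail of the geometric series with ratio
  \<open>cmod w * q\<close>.\<close>

lemma norm_neumann_tail:
  assumes "\<phi> \<in> F_theta G \<theta>"
  shows "norm_theta G \<theta> (neumann_tail w N \<phi>) \<le>
    (cmod w * q) ^ N / (1 - cmod w * q) * (1 + 2 / \<theta>) * norm_theta G \<theta> \<phi>"
proof -
  obtain A B where est: "lip_est G \<theta> A B \<phi>" and eq: "norm_theta G \<theta> \<phi> = A + B"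
    using F_theta_lip_est[OF assms \<theta>] .
  let ?R = "(cmod w * q) ^ N / (1 - cmod w * q)"
  have "norm_theta G \<theta> (neumann_tail w N \<phi>) \<le> ?R * A + ?R * (B + 2 / \<theta> * A)"
    by (rule norm_theta_le[OF lip_est_neumann_tail[OF est]])
  also have "\<dots> = ?R * (A + B + 2 / \<theta> * A)"
    by (simp only: distrib_left add.assoc)
  also have "\<dots> \<le> ?R * ((1 + 2 / \<theta>) * (A + B))"
  proof (rule mult_left_mono)
    have "2 / \<theta> * A \<le> 2 / \<theta> * (A + B)"
      using est \<theta> by (intro mult_left_mono) (auto simp: lip_est_def)
    then show "A + B + 2 / \<theta> * A \<le> (1 + 2 / \<theta>) * (A + B)"
      by (simp only: distrib_right mult_1)
  qed (use w in simp)
  finally show ?thesis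
    by (simp only: eq mult.assoc)
qed

lemma summable_neumann:
  assumes "\<phi> \<in> F_theta G \<theta>"
  shows "summable (\<lambda>n. w ^ n * (transfer_op G ^^ n) \<phi> p)"
proof (cases "p \<in> right_paths G")
  case True
  obtain A B where est: "lip_est G \<theta> A B \<phi>"
    using F_theta_lip_est[OF assms \<theta>] .
  have "summable (\<lambda>n. (cmod w * q) ^ n * A)"
    using w by (intro summable_mult2 summable_geometric) simp
  then show ?thesis
    by (rule summable_comparison_test')
      (use lip_est_scaled_transfer_op_funpow[OF est \<theta>] True in \<open>auto simp: lip_est_def\<close>)
next
  case False
  then have "(transfer_op G ^^ n) \<phi> p = 0" for n
    using assms by (intro transfer_op_funpow_outside) (auto simp: F_theta_def)
  then show ?thesis by simp
qed

lemma neumann_tail_eq: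
  assumes "\<phi> \<in> F_theta G \<theta>"
  shows "neumann_tail w N \<phi> = (\<lambda>p. neumann_tail w 0 \<phi> p - (\<Sum>n<N. w ^ n * (transfer_op G ^^ n) \<phi> p))"
  using suminf_split_initial_segment[OF summable_neumann[OF assms], of _ N]
  by (auto simp: neumann_tail_def)

lemma F_theta_id_minus_scaled_transfer:
  assumes "\<phi> \<in> F_theta G \<theta>"
  shows "(\<lambda>p. \<phi> p - w * transfer_op G \<phi> p) \<in> F_theta G \<theta>"
proof -
  obtain A B where est: "lip_est G \<theta> A B \<phi>"
    using F_theta_lip_est[OF assms \<theta>] .
  show ?thesis
    using lip_est_F_theta[OF lip_est_diff[OF est lip_est_scaled_transfer_op_funpow[OF est \<theta>, of w 1]]]
    by simp
qed

lemma neumann_right_inverse: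
  assumes "\<phi> \<in> F_theta G \<theta>"
  shows "neumann_tail w 0 \<phi> p - w * transfer_op G (neumann_tail w 0 \<phi>) p = \<phi> p"
proof (cases "p \<in> right_paths G")
  case True
  have "w * transfer_op G (neumann_tail w 0 \<phi>) p =
      w * (\<Sum>r\<in>preimages G (Suc 0) p. \<Sum>n. w ^ n * (transfer_op G ^^ n) \<phi> r)"
    by (simp add: transfer_op_eq[OF True] neumann_tail_def)
  \<comment> \<open>A fibre is finite, so summation over it commutes with the series; applying the
    operator then only advances the index of the series by one.\<close>
  also have "\<dots> = w * (\<Sum>n. \<Sum>r\<in>preimages G (Suc 0) p. w ^ n * (transfer_op G ^^ n) \<phi> r)"
    by (subst suminf_sum) (auto intro: summable_neumann assms)
  also have "\<dots> = (\<Sum>n. w * (\<Sum>r\<in>preimages G (Suc 0) p. w ^ n * (transfer_op G ^^ n) \<phi> r))"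
    by (rule suminf_mult[symmetric]) (auto intro!: summable_sum summable_neumann assms)
  also have "\<dots> = (\<Sum>n. w ^ Suc n * (transfer_op G ^^ Suc n) \<phi> p)"
    by (simp add: transfer_op_eq[OF True] sum_distrib_left mult.assoc)
  also have "\<dots> = neumann_tail w 0 \<phi> p - \<phi> p"
    using suminf_split_head[OF summable_neumann[OF assms, of p]] by (simp add: neumann_tail_def)
  finally show ?thesis by simp
next
  case False
  then have "(transfer_op G ^^ n) \<phi> p = 0" for n
    using assms by (intro transfer_op_funpow_outside) (auto simp: F_theta_def)
  then show ?thesis
    using False assms by (simp add: neumann_tail_def transfer_op_def F_theta_def)
qed

lemma neumann_left_inverse:
  assumes "\<phi> \<in> F_theta G \<theta>"
  shows "neumann_tail w 0 (\<lambda>p. \<phi> p - w * transfer_op G \<phi> p) p = \<phi> p"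
proof (cases "p \<in> right_paths G")
  case True
  let ?t = "\<lambda>n. w ^ n * (transfer_op G ^^ n) \<phi> p"
  \<comment> \<open>Each term becomes a difference of consecutive Neumann terms. The series
    telescopes because the terms of a convergent series tend to 0.\<close>
  have "w ^ n * (transfer_op G ^^ n) (\<lambda>p. \<phi> p - w * transfer_op G \<phi> p) p = ?t n - ?t (Suc n)" for n
    by (simp add: transfer_op_funpow_diff_scale[OF True] funpow_swap1 algebra_simps)
  moreover have "(\<lambda>n. ?t n - ?t (Suc n)) sums (?t 0 - 0)"
    by (rule telescope_sums') (rule summable_LIMSEQ_zero[OF summable_neumann[OF assms]])
  ultimately show ?thesis
    by (simp add: neumann_tail_def sums_iff)
next
  case False
  have "(transfer_op G ^^ n) (\<lambda>p. \<phi> p - w * transfer_op G \<phi> p) p = 0" for n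
    using assms False
    by (intro transfer_op_funpow_outside) (auto simp: F_theta_def transfer_op_def)
  then show ?thesis
    using assms False by (simp add: neumann_tail_def F_theta_def)
qed

end

section \<open>Multiplication operators and the resolvent\<close>

lemma bounded_op_mult_op:
  assumes "g \<in> F_theta G \<theta>" and \<theta>: "0 < \<theta>" "\<theta> < 1"
  shows "bounded_op G \<theta> (mult_op g)"
proof -
  obtain A B where g: "lip_est G \<theta> A B g"
    using F_theta_lip_est[OF assms] .
  have "norm_theta G \<theta> (mult_op g \<phi>) \<le> (A + B) * norm_theta G \<theta> \<phi> \<and> mult_op g \<phi> \<in> F_theta G \<theta>"
    if F: "\<phi> \<in> F_theta G \<theta>" for \<phi>
  proof -
    obtain A' B' where \<phi>: "lip_est G \<theta> A' B' \<phi>" "norm_theta G \<theta> \<phi> = A' + B'"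
      using F_theta_lip_est[OF F \<theta>] .
    have est: "lip_est G \<theta> (A * A') (A * B' + A' * B) (mult_op g \<phi>)"
      unfolding mult_op_def by (rule lip_est_mult[OF g \<phi>(1) \<theta>(1)])
    \<comment> \<open>The product rule gives the expansion of \<open>(A + B) * (A' + B')\<close>
      without the term \<open>B * B'\<close>.\<close>
    have "0 \<le> B * B'"
      using g \<phi> by (auto simp: lip_est_def)
    then have "A * A' + (A * B' + A' * B) \<le> (A + B) * (A' + B')"
      by (simp add: algebra_simps)
    then show ?thesis
      using norm_theta_le[OF est] lip_est_F_theta[OF est] \<phi>(2) by simp
  qed
  then show ?thesis
    unfolding bounded_op_def by (intro conjI exI[where x = "A + B"]) (auto simp: mult_op_def algebra_simps)
qed

text \<open>The modulus is \<open>q powr (1 / 2 - Im s)\<close>, and the exponent is below -1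
  exactly for \<open>Im s > 3 / 2\<close>: this is the origin of the half-plane.\<close>

lemma cmod_weight_less:
  assumes "Im s > 3 / 2"
  shows "cmod (weight q s) * q < 1"
proof -
  have "cmod (weight q s) = q powr (1 / 2 - Im s)"
    using q_gt_1 by (simp add: weight_def norm_powr_real_powr)
  also have "\<dots> < q powr (-1)"
    using assms q_gt_1 by (intro powr_less_mono) auto
  finally show ?thesis
    using q_gt_1 by (simp add: powr_minus field_simps)
qed

lemma resolvent_properties:
  assumes "Im s > 3 / 2" and \<theta>: "0 < \<theta>" "\<theta> < 1"
  shows "bij_betw (id_minus_transfer G q s) (F_theta G \<theta>) (F_theta G \<theta>)"
    and "bounded_op G \<theta> (resolvent G q \<theta> s)"
    and "op_tendsto G \<theta> (neumann_sum G q s) (resolvent G q \<theta> s)"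
proof -
  define w where "w = weight q s"
  have w: "cmod w * q < 1"
    unfolding w_def using assms cmod_weight_less by blast
  note [simp] = neumann_tail_F_theta[OF w \<theta>]
  have inv: "id_minus_transfer G q s \<phi> \<in> F_theta G \<theta>"
    "neumann_tail w 0 (id_minus_transfer G q s \<phi>) = \<phi>"
    "id_minus_transfer G q s (neumann_tail w 0 \<phi>) = \<phi>" if "\<phi> \<in> F_theta G \<theta>" for \<phi>
    using F_theta_id_minus_scaled_transfer[OF w \<theta> that] neumann_left_inverse[OF w \<theta> that]
      neumann_right_inverse[OF w \<theta> that]
    by (simp_all add: id_minus_transfer_def w_def fun_eq_iff)
  show bij: "bij_betw (id_minus_transfer G q s) (F_theta G \<theta>) (F_theta G \<theta>)"
    by (rule bij_betw_byWitness[where f' = "neumann_tail w 0"]) (auto simp: inv)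
  \<comment> \<open>The resolvent is defined as an inverse function, whose values off
    \<open>F_theta\<close> are unspecified. On \<open>F_theta\<close> it agrees with the two-sided
    inverse given by the series, and all its properties are read off there.\<close>
  have res: "resolvent G q \<theta> s \<phi> = neumann_tail w 0 \<phi>" if "\<phi> \<in> F_theta G \<theta>" for \<phi>
    unfolding resolvent_def
    by (rule inv_into_f_eq[OF bij_betw_imp_inj_on[OF bij]]) (use that inv in auto)
  let ?C = "1 / (1 - cmod w * q) * (1 + 2 / \<theta>)"
  show "bounded_op G \<theta> (resolvent G q \<theta> s)"
    unfolding bounded_op_def
  proof (intro conjI ballI allI exI[where x = ?C])
    fix \<phi> \<psi> assume \<phi>: "\<phi> \<in> F_theta G \<theta>" and \<psi>: "\<psi> \<in> F_theta G \<theta>"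
    obtain A B where "lip_est G \<theta> A B \<phi>" using F_theta_lip_est[OF \<phi> \<theta>] .
    moreover obtain A' B' where "lip_est G \<theta> A' B' \<psi>" using F_theta_lip_est[OF \<psi> \<theta>] .
    ultimately have sum: "(\<lambda>p. \<phi> p + \<psi> p) \<in> F_theta G \<theta>"
      using lip_est_F_theta[OF lip_est_diff[OF _ lip_est_uminus]] by fastforce
    have "neumann_tail w 0 (\<lambda>p. \<phi> p + \<psi> p) p = neumann_tail w 0 \<phi> p + neumann_tail w 0 \<psi> p" for p
    proof (cases "p \<in> right_paths G")
      case True
      have "w ^ n * (transfer_op G ^^ n) (\<lambda>p. \<phi> p + \<psi> p) p =
          w ^ n * (transfer_op G ^^ n) \<phi> p + w ^ n * (transfer_op G ^^ n) \<psi> p" for n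
        by (simp add: transfer_op_funpow[OF True] sum.distrib distrib_left)
      then show ?thesis
        by (simp add: neumann_tail_def
            suminf_add[OF summable_neumann[OF w \<theta> \<phi>] summable_neumann[OF w \<theta> \<psi>]])
    qed (use \<phi> \<psi> sum neumann_tail_F_theta[OF w \<theta>] in \<open>auto simp: F_theta_def\<close>)
    then show "resolvent G q \<theta> s (\<lambda>p. \<phi> p + \<psi> p) = (\<lambda>p. resolvent G q \<theta> s \<phi> p + resolvent G q \<theta> s \<psi> p)"
      using \<phi> \<psi> sum by (simp add: res fun_eq_iff)
  next
    fix \<phi> and c :: complex assume \<phi>: "\<phi> \<in> F_theta G \<theta>"
    obtain A B where "lip_est G \<theta> A B \<phi>" using F_theta_lip_est[OF \<phi> \<theta>] .
    then have scale: "(\<lambda>p. c * \<phi> p) \<in> F_theta G \<theta>"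
      using lip_est_F_theta[OF lip_est_scale] by blast
    have "neumann_tail w 0 (\<lambda>p. c * \<phi> p) p = c * neumann_tail w 0 \<phi> p" for p
    proof (cases "p \<in> right_paths G")
      case True
      have "w ^ n * (transfer_op G ^^ n) (\<lambda>p. c * \<phi> p) p = c * (w ^ n * (transfer_op G ^^ n) \<phi> p)" for n
        by (simp add: transfer_op_funpow[OF True] mult.left_commute flip: sum_distrib_left)
      then show ?thesis
        by (simp only: neumann_tail_def add_0_right suminf_mult[OF summable_neumann[OF w \<theta> \<phi>]])
    qed (use \<phi> scale neumann_tail_F_theta[OF w \<theta>] in \<open>auto simp: F_theta_def\<close>)
    then show "resolvent G q \<theta> s (\<lambda>p. c * \<phi> p) = (\<lambda>p. c * resolvent G q \<theta> s \<phi> p)"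
      using \<phi> scale by (simp add: res fun_eq_iff)
  next
    fix \<phi> assume \<phi>: "\<phi> \<in> F_theta G \<theta>"
    show "norm_theta G \<theta> (resolvent G q \<theta> s \<phi>) \<le> ?C * norm_theta G \<theta> \<phi>"
      using norm_neumann_tail[OF w \<theta> \<phi>, of 0] by (simp add: res \<phi>)
  qed (simp add: res)
  show "op_tendsto G \<theta> (neumann_sum G q s) (resolvent G q \<theta> s)"
    unfolding op_tendsto_def
  proof (intro allI impI)
    fix \<epsilon> :: real assume "0 < \<epsilon>"
    \<comment> \<open>This is the operator bound of the \<open>N\<close>-th tail; the error of the
      \<open>N\<close>-th partial sum is minus that tail.\<close>
    have "(\<lambda>N. (cmod w * q) ^ N / (1 - cmod w * q) * (1 + 2 / \<theta>)) \<longlonglongrightarrow> 0 / (1 - cmod w * q) * (1 + 2 / \<theta>)"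
      by (intro tendsto_intros LIMSEQ_realpow_zero) (use w in auto)
    then have "\<forall>\<^sub>F N in sequentially. (cmod w * q) ^ N / (1 - cmod w * q) * (1 + 2 / \<theta>) < \<epsilon>"
      using \<open>0 < \<epsilon>\<close> by (intro order_tendstoD(2)) auto
    then show "\<forall>\<^sub>F N in sequentially. \<forall>\<phi>\<in>F_theta G \<theta>.
        norm_theta G \<theta> (\<lambda>p. neumann_sum G q s N \<phi> p - resolvent G q \<theta> s \<phi> p) \<le> \<epsilon> * norm_theta G \<theta> \<phi>"
    proof (eventually_elim, intro ballI)
      fix N \<phi>
      assume N: "(cmod w * q) ^ N / (1 - cmod w * q) * (1 + 2 / \<theta>) < \<epsilon>" and \<phi>: "\<phi> \<in> F_theta G \<theta>"
      have "(\<lambda>p. neumann_sum G q s N \<phi> p - resolvent G q \<theta> s \<phi> p) = (\<lambda>p. - neumann_tail w N \<phi> p)"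
        by (simp only: res[OF \<phi>] neumann_sum_def w_def[symmetric] neumann_tail_eq[OF w \<theta> \<phi>, of N] minus_diff_eq)
      moreover have "norm_theta G \<theta> (\<lambda>p. - \<psi> p) = norm_theta G \<theta> \<psi>" for \<psi>
        by (simp add: norm_theta_def lip_bounds_def norm_minus_commute)
      moreover have "0 \<le> norm_theta G \<theta> \<phi>"
        using F_theta_lip_est[OF \<phi> \<theta>] unfolding lip_est_def by (metis add_nonneg_nonneg)
      then have "(cmod w * q) ^ N / (1 - cmod w * q) * (1 + 2 / \<theta>) * norm_theta G \<theta> \<phi> \<le> \<epsilon> * norm_theta G \<theta> \<phi>"
        using N by (intro mult_right_mono) auto
      ultimately show "norm_theta G \<theta> (\<lambda>p. neumann_sum G q s N \<phi> p - resolvent G q \<theta> s \<phi> p)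
          \<le> \<epsilon> * norm_theta G \<theta> \<phi>"
        using norm_neumann_tail[OF w \<theta> \<phi>, of N] by simp
    qed
  qed
qed

end

section \<open>Locally constant functions\<close>

lemma F_finD:
  "g \<in> F_fin G k \<Longrightarrow> p \<in> right_paths G \<Longrightarrow> p' \<in> right_paths G \<Longrightarrow> (\<And>i. i < k \<Longrightarrow> p i = p' i)
    \<Longrightarrow> g p = g p'"
  unfolding F_fin_def by blast

lemma F_fin_outside: "g \<in> F_fin G k \<Longrightarrow> p \<notin> right_paths G \<Longrightarrow> g p = 0"
  unfolding F_fin_def by blast

lemma F_finI:
  "(\<And>p p'. p \<in> right_paths G \<Longrightarrow> p' \<in> right_paths G \<Longrightarrow> \<forall>i<k. p i = p' i \<Longrightarrow> g p = g p')
    \<Longrightarrow> (\<And>p. p \<notin> right_paths G \<Longrightarrow> g p = 0) \<Longrightarrow> g \<in> F_fin G k"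
  unfolding F_fin_def by blast

lemma F_fin_mono:
  assumes "g \<in> F_fin G k" "k \<le> k'"
  shows "g \<in> F_fin G k'"
proof (rule F_finI)
  show "g p = g p'"
    if "p \<in> right_paths G" "p' \<in> right_paths G" "\<forall>i<k'. p i = p' i" for p p'
    by (rule F_finD[OF assms(1)]) (use that assms(2) in \<open>simp_all add: less_le_trans\<close>)
  show "g p = 0" if "p \<notin> right_paths G" for p
    by (rule F_fin_outside[OF assms(1) that])
qed

context regular_graph
begin

lemma topspace_right_top: "topspace (right_top G) = right_paths G"
  by (auto simp: right_top_def topspace_subtopology right_paths_def PiE_def)

text \<open>The edge set is finite, so the full sequence space is compact by Tychonoff.
  Admissibility is a closed condition, since a violation is visible in two consecutive
  coordinates.\<close>

lemma compact_space_right_top: "compact_space (right_top G)"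
proof -
  let ?X = "product_topology (\<lambda>_. discrete_topology (parcs G)) (UNIV :: nat set)"
  have "compact_space ?X"
    by (simp add: compact_space_product_topology compact_space_discrete_topology)
  moreover have "closedin ?X (right_paths G)"
  proof -
    have sub: "right_paths G \<subseteq> topspace ?X"
      by (auto simp: right_paths_def)
    have "openin ?X (topspace ?X - right_paths G)"
    proof (subst openin_subopen, intro ballI)
      fix p assume p: "p \<in> topspace ?X - right_paths G"
      then obtain i where i: "\<not> follows (p i) (p (Suc i))"
        by (auto simp: right_paths_def PiE_def Pi_def)
      let ?U = "\<lambda>j. if j = i \<or> j = Suc i then {p j} else parcs G"
      have "openin ?X (PiE UNIV ?U)"
        using p by (subst openin_PiE_gen) (auto simp: PiE_def Pi_def intro!: finite_subset[of _ "{i, Suc i}"])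
      moreover have "PiE UNIV ?U \<subseteq> topspace ?X - right_paths G"
      proof (intro subsetI DiffI)
        fix r assume r: "r \<in> PiE UNIV ?U"
        then have mem: "r j \<in> ?U j" for j
          by (auto simp: PiE_def Pi_def)
        have "p j \<in> parcs G" for j
          using p by (auto simp: PiE_def Pi_def)
        then have "r i = p i" "r (Suc i) = p (Suc i)" "r j \<in> parcs G" for j
          using mem[of i] mem[of "Suc i"] mem[of j] by (auto split: if_splits)
        then show "r \<in> topspace ?X" "r \<notin> right_paths G"
          using i right_paths_follows[of r G i] by auto
      qed
      moreover have "p \<in> PiE UNIV ?U"
        using p by (auto simp: PiE_def Pi_def)
      ultimately show "\<exists>T. openin ?X T \<and> p \<in> T \<and> T \<subseteq> topspace ?X - right_paths G"
        by blast
    qed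
    then show ?thesis
      using sub by (simp add: closedin_def)
  qed
  ultimately show ?thesis
    unfolding right_top_def by (simp add: closedin_compact_space compact_space_subtopology)
qed

text \<open>A basic open set of the product constrains finitely many coordinates, and a prefix
  reaching past all of them fixes every constraint.\<close>

lemma openin_right_top_cylinder:
  assumes "openin (right_top G) U" "p \<in> U"
  obtains k where "cylinder G (map p [0..<k]) \<subseteq> U"
proof -
  let ?X = "product_topology (\<lambda>_. discrete_topology (parcs G)) (UNIV :: nat set)"
  obtain V where V: "openin ?X V" "U = V \<inter> right_paths G"
    using assms(1) by (auto simp: right_top_def openin_subtopology)
  then obtain W where W: "finite {i. W i \<noteq> parcs G}" "p \<in> PiE UNIV W" "PiE UNIV W \<subseteq> V"
    using assms(2) by (auto simp: openin_product_topology_alt)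
  obtain k where k: "{i. W i \<noteq> parcs G} \<subseteq> {..<k}"
    using W(1) finite_nat_iff_bounded by blast
  show thesis
  proof
    show "cylinder G (map p [0..<k]) \<subseteq> U"
    proof
      fix r assume "r \<in> cylinder G (map p [0..<k])"
      then have r: "r \<in> right_paths G" "\<forall>i<k. r i = p i"
        by (auto simp: mem_cylinder_map_upt)
      have "r i \<in> W i" for i
        using r W(2) k right_paths_arc[OF r(1), of i] by (cases "i < k") (auto simp: PiE_def Pi_def)
      then show "r \<in> U"
        using W(3) V(2) r(1) by (auto simp: PiE_def Pi_def)
    qed
  qed
qed

text \<open>Local constancy supplies a cylinder length at each point, with no uniform bound.
  Compactness leaves finitely many cylinders, and the longest of their lengths serves
  everywhere.\<close>

lemma C_lc_right_top_F_fin: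
  assumes "g \<in> C_lc (right_top G)"
  obtains k where "k \<ge> 1" "g \<in> F_fin G k"
proof -
  have "\<exists>k. g constant_on cylinder G (map p [0..<k])" if p: "p \<in> right_paths G" for p
  proof -
    obtain U where U: "openin (right_top G) U" "p \<in> U" "g constant_on U"
      using assms p by (auto simp: C_lc_def topspace_right_top)
    obtain k where "cylinder G (map p [0..<k]) \<subseteq> U"
      using openin_right_top_cylinder[OF U(1,2)] .
    then show ?thesis
      using U(3) constant_on_subset by blast
  qed
  then obtain K where K: "\<And>p. p \<in> right_paths G \<Longrightarrow> g constant_on cylinder G (map p [0..<K p])"
    by metis
  let ?C = "\<lambda>p. cylinder G (map p [0..<K p])"
  have "openin (right_top G) (?C p)" if "p \<in> right_paths G" for p
  proof -
    let ?W = "\<lambda>i. if i < K p then {p i} else parcs G"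
    have "?C p = PiE UNIV ?W \<inter> right_paths G"
      by (auto simp: mem_cylinder_map_upt PiE_def Pi_def right_paths_arc split: if_splits)
    moreover have "openin (product_topology (\<lambda>_. discrete_topology (parcs G)) UNIV) (PiE UNIV ?W)"
      using right_paths_arc[OF that]
      by (subst openin_PiE_gen) (auto intro!: finite_subset[of _ "{..<K p}"])
    ultimately show ?thesis
      by (auto simp: right_top_def openin_subtopology)
  qed
  moreover have "right_paths G \<subseteq> \<Union>(?C ` right_paths G)"
    by (auto simp: mem_cylinder_map_upt)
  ultimately obtain F where F: "finite F" "F \<subseteq> ?C ` right_paths G" "right_paths G \<subseteq> \<Union>F"
    using compactinD[OF compact_space_right_top[unfolded compact_space_def], of "?C ` right_paths G"]
    unfolding topspace_right_top by blast
  obtain P where "finite P" "P \<subseteq> right_paths G" "F = ?C ` P"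
    using finite_subset_image[OF F(1,2)] by blast
  with F(3) have P: "finite P" "P \<subseteq> right_paths G" "right_paths G \<subseteq> (\<Union>p\<in>P. ?C p)"
    by auto
  \<comment> \<open>Inserting 0 makes the maximum meaningful for every finite set, and
    \<open>Suc\<close> ensures \<open>k \<ge> 1\<close>.\<close>
  define k where "k = Suc (Max (insert 0 (K ` P)))"
  have "g p = g p'" if p: "p \<in> right_paths G" "p' \<in> right_paths G" "\<forall>i<k. p i = p' i" for p p'
  proof -
    obtain r where r: "r \<in> P" "p \<in> ?C r"
      using P p by blast
    have "K r \<le> Max (insert 0 (K ` P))"
      using P(1) r(1) by (intro Max_ge) auto
    then have "p' \<in> ?C r"
      using r p by (auto simp: mem_cylinder_map_upt k_def)
    then show ?thesis
      using r(2) K[OF subsetD[OF P(2) r(1)]] by (auto simp: constant_on_def)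
  qed
  then have "g \<in> F_fin G k"
    by (rule F_finI) (use assms in \<open>auto simp: C_lc_def topspace_right_top\<close>)
  then show thesis
    using that[of k] by (simp add: k_def)
qed

lemma F_fin_bounded:
  assumes "g \<in> F_fin G k"
  obtains M where "\<And>p. p \<in> right_paths G \<Longrightarrow> cmod (g p) \<le> M"
proof -
  have "finite (g ` right_paths G)"
  proof (rule finite_surj[OF finite_words])
    show "g ` right_paths G \<subseteq> (\<lambda>v. g (SOME p. p \<in> cylinder G v)) ` words G k"
    proof (rule image_subsetI)
      fix p assume p: "p \<in> right_paths G"
      have "(SOME r. r \<in> cylinder G (map p [0..<k])) \<in> cylinder G (map p [0..<k])"
        unfolding some_in_eq using p mem_cylinder_map_upt by blast
      then have "g p = g (SOME r. r \<in> cylinder G (map p [0..<k]))"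
        unfolding mem_cylinder_map_upt using p by (intro F_finD[OF assms]) simp_all
      then show "g p \<in> (\<lambda>v. g (SOME p. p \<in> cylinder G v)) ` words G k"
        using p by (auto simp: words_def)
    qed
  qed
  then have "bounded (g ` right_paths G)"
    by (rule finite_imp_bounded)
  then show thesis
    using that by (auto simp: bounded_iff)
qed

end

section \<open>Matrix traces and periodic paths\<close>

text \<open>For \<open>n = 0\<close> the condition is empty and every path qualifies; hence the
  recurring side condition \<open>1 \<le> n\<close>.\<close>

definition periodic_paths :: "'v pair_pre_digraph \<Rightarrow> nat \<Rightarrow> (nat \<Rightarrow> 'v \<times> 'v) set" where
  "periodic_paths G n = {p \<in> right_paths G. \<forall>i. p (i + n) = p i}"

lemma periodic_add_mult:
  fixes p :: "nat \<Rightarrow> 'a"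
  assumes "\<forall>i. p (i + n) = p i"
  shows "p (i + n * j) = p i"
proof (induction j)
  case (Suc j)
  have "p (i + n * Suc j) = p (i + n * j + n)"
    by (simp add: ac_simps)
  then show ?case
    using assms Suc by simp
qed simp

lemma periodic_mod:
  fixes p :: "nat \<Rightarrow> 'a"
  assumes "\<forall>i. p (i + n) = p i"
  shows "p (i mod n) = p i"
  using periodic_add_mult[OF assms, of "i mod n" "i div n"] by simp

lemma flat_trace_eqI:
  assumes "\<forall>\<^sub>F m in sequentially. fin_trace G m A = t"
  shows "flat_trace G A = t"
proof -
  have "t' = t" if "\<forall>\<^sub>F m in sequentially. fin_trace G m A = t'" for t'
    using eventually_happens'[OF sequentially_bot eventually_conj[OF assms that]] by auto
  then have "(THE t. \<forall>\<^sub>F m in sequentially. fin_trace G m A = t) = t"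
    using assms by (intro the_equality)
  then show ?thesis
    using assms by (auto simp: flat_trace_def)
qed

context regular_graph
begin

text \<open>
  Replacing the tail of a periodic path from time \<open>n\<close> on by \<open>p\<close> is undone by repeating its first
  \<open>n\<close> edges. This turns fixed points of the \<open>n\<close>-th power of the shift into preimages of \<open>p\<close>.
\<close>

lemma bij_betw_periodic_preimages:
  assumes p: "p \<in> right_paths G" and "1 \<le> k" "1 \<le> n"
  shows "bij_betw (\<lambda>r i. if i < n then r i else p (i - n))
    (periodic_paths G n \<inter> cylinder G (map p [0..<k])) (preimages G n p \<inter> cylinder G (map p [0..<k]))"
proof (rule bij_betw_byWitness[where f' = "\<lambda>r i. r (i mod n)"])
  show "\<forall>r\<in>periodic_paths G n \<inter> cylinder G (map p [0..<k]).
      (\<lambda>i. if i mod n < n then r (i mod n) else p (i mod n - n)) = r"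
  proof (intro ballI ext)
    fix r i assume "r \<in> periodic_paths G n \<inter> cylinder G (map p [0..<k])"
    then have "r (i mod n) = r i"
      by (intro periodic_mod) (simp add: periodic_paths_def)
    then show "(if i mod n < n then r (i mod n) else p (i mod n - n)) = r i"
      using \<open>1 \<le> n\<close> by simp
  qed
  show "\<forall>r\<in>preimages G n p \<inter> cylinder G (map p [0..<k]).
      (\<lambda>i. if i < n then r (i mod n) else p (i - n)) = r"
  proof (intro ballI ext)
    fix r i assume "r \<in> preimages G n p \<inter> cylinder G (map p [0..<k])"
    then show "(if i < n then r (i mod n) else p (i - n)) = r i"
      by (auto simp: preimages_def dest: spec[where x = "i - n"])
  qed
  show "(\<lambda>r i. if i < n then r i else p (i - n)) ` (periodic_paths G n \<inter> cylinder G (map p [0..<k]))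
      \<subseteq> preimages G n p \<inter> cylinder G (map p [0..<k])"
  proof (rule image_subsetI)
    fix r assume "r \<in> periodic_paths G n \<inter> cylinder G (map p [0..<k])"
    then have r: "r \<in> right_paths G" "\<And>i. r (i + n) = r i" "\<And>i. i < k \<Longrightarrow> r i = p i"
      by (auto simp: periodic_paths_def mem_cylinder_map_upt)
    \<comment> \<open>The edge after \<open>r (n - 1)\<close> is \<open>r n = r 0\<close>, and
      \<open>r 0 = p 0\<close> because the cylinder fixes at least one edge.\<close>
    have "follows (r (n - 1)) (p 0)"
      using right_paths_follows[OF r(1), of "n - 1"] r(2)[of 0] r(3)[of 0] assms by simp
    then have "(\<lambda>i. if i < n then r i else p (i - n)) \<in> right_paths G"
      by (rule right_paths_splice[OF r(1) p])
    \<comment> \<open>The path \<open>p\<close> need not be periodic, but its first \<open>k\<close>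
      edges agree with those of \<open>r\<close> and so repeat with period \<open>n\<close>.\<close>
    moreover have "p (i - n) = p i" if "i < k" "n \<le> i" for i
      using r(2)[of "i - n"] r(3)[of i] r(3)[of "i - n"] that by simp
    ultimately show "(\<lambda>i. if i < n then r i else p (i - n)) \<in> preimages G n p \<inter> cylinder G (map p [0..<k])"
      using r(3) by (simp add: preimages_def mem_cylinder_map_upt)
  qed
  show "(\<lambda>r i. r (i mod n)) ` (preimages G n p \<inter> cylinder G (map p [0..<k]))
      \<subseteq> periodic_paths G n \<inter> cylinder G (map p [0..<k])"
  proof (rule image_subsetI)
    fix r assume "r \<in> preimages G n p \<inter> cylinder G (map p [0..<k])"
    then have r: "r \<in> right_paths G" "\<And>i. r (i + n) = p i" "\<And>i. i < k \<Longrightarrow> r i = p i"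
      by (auto simp: preimages_def mem_cylinder_map_upt)
    have "follows (r (i mod n)) (r (Suc i mod n))" for i
    proof (cases "Suc (i mod n) = n")
      case True
      then have "r (Suc i mod n) = r n"
        using r(2)[of 0] r(3)[of 0] assms by (simp add: mod_Suc)
      then show ?thesis
        using right_paths_follows[OF r(1), of "i mod n"] True by simp
    next
      case False
      then show ?thesis
        using right_paths_follows[OF r(1), of "i mod n"] by (simp add: mod_Suc)
    qed
    then have "(\<lambda>i. r (i mod n)) \<in> right_paths G"
      using right_paths_arc[OF r(1)] by (simp add: right_paths_def)
    \<comment> \<open>The word may be longer than \<open>n\<close>. Strong induction steps back by
      \<open>n\<close>: \<open>p (i - n)\<close> is \<open>r i\<close> by the preimage condition,
      and \<open>r i\<close> is \<open>p i\<close> inside the cylinder.\<close>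
    moreover have "r (i mod n) = p i" if "i < k" for i
      using that
    proof (induction i rule: less_induct)
      case (less i)
      show ?case
      proof (cases "i < n")
        case False
        then have "r ((i - n) mod n) = p (i - n)"
          using less.prems \<open>1 \<le> n\<close> by (intro less.IH) auto
        also have "\<dots> = r i"
          using r(2)[of "i - n"] False by simp
        finally show ?thesis
          using False r(3)[OF less.prems] by (simp add: le_mod_geq)
      qed (use r(3)[OF less.prems] in simp)
    qed
    ultimately show "(\<lambda>i. r (i mod n)) \<in> periodic_paths G n \<inter> cylinder G (map p [0..<k])"
      by (simp add: periodic_paths_def mem_cylinder_map_upt)
  qed
qed

lemma finite_periodic_paths:
  assumes "1 \<le> n"
  shows "finite (periodic_paths G n)"
proof (rule inj_on_finite)
  show "inj_on (\<lambda>p. map p [0..<n]) (periodic_paths G n)"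
  proof (rule inj_onI)
    fix p r assume pr: "p \<in> periodic_paths G n" "r \<in> periodic_paths G n" "map p [0..<n] = map r [0..<n]"
    have "p i = r i" for i
    proof -
      have "p (i mod n) = r (i mod n)"
        using pr(3) assms unfolding map_upt_eq_iff by simp
      then show ?thesis
        using pr(1,2) periodic_mod[of p n i] periodic_mod[of r n i] by (simp add: periodic_paths_def)
    qed
    then show "p = r" by blast
  qed
  show "(\<lambda>p. map p [0..<n]) ` periodic_paths G n \<subseteq> words G n"
    by (auto simp: words_def periodic_paths_def)
qed (rule finite_words)

lemma periodic_paths_cylinder:
  "length v = k \<Longrightarrow> {p \<in> periodic_paths G n. map p [0..<k] = v} = periodic_paths G n \<inter> cylinder G v"
  by (auto simp: periodic_paths_def cylinder_def)

lemma words_SOME: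
  assumes "v \<in> words G k"
  shows "(SOME p. p \<in> cylinder G v) \<in> right_paths G" "map (SOME p. p \<in> cylinder G v) [0..<k] = v"
proof -
  have "length v = k" "cylinder G v \<noteq> {}"
    using assms by (auto simp: words_def cylinder_def)
  then have "(SOME p. p \<in> cylinder G v) \<in> cylinder G v"
    by (simp add: some_in_eq)
  then show "(SOME p. p \<in> cylinder G v) \<in> right_paths G" "map (SOME p. p \<in> cylinder G v) [0..<k] = v"
    using \<open>length v = k\<close> by (auto simp: cylinder_def)
qed

text \<open>The diagonal entry of a word is the value of \<open>g\<close> there times the number of
  preimages returning to its cylinder. The lengths \<open>k\<close> and \<open>n\<close> are
  unrelated, and the result does not involve \<open>k\<close>: this independence is the
  stabilisation demanded by the flat trace.\<close>

lemma fin_trace_transfer_op: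
  assumes g: "g \<in> F_fin G k" and k: "1 \<le> k" and n: "1 \<le> n"
  shows "fin_trace G k (mult_op g \<circ> (transfer_op G ^^ n)) = sum g (periodic_paths G n)"
proof -
  have "op_matrix G (mult_op g \<circ> (transfer_op G ^^ n)) v v =
      (\<Sum>p | p \<in> periodic_paths G n \<and> map p [0..<k] = v. g p)" if v: "v \<in> words G k" for v
  proof -
    define p where "p = (SOME p. p \<in> cylinder G v)"
    have p: "p \<in> right_paths G" and vp: "v = map p [0..<k]"
      using words_SOME[OF v] by (simp_all add: p_def)
    have "op_matrix G (mult_op g \<circ> (transfer_op G ^^ n)) v v =
        g p * (\<Sum>r\<in>preimages G n p. indicator (cylinder G v) r)"
      unfolding op_matrix_def p_def[symmetric] by (simp add: mult_op_def transfer_op_funpow[OF p])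
    also have "\<dots> = g p * card (preimages G n p \<inter> cylinder G v)"
      by (simp add: indicator_def sum_of_bool_eq finite_preimages[OF p])
    also have "\<dots> = g p * card (periodic_paths G n \<inter> cylinder G v)"
      using bij_betw_same_card[OF bij_betw_periodic_preimages[OF p k n]] by (simp add: vp)
    also have "\<dots> = (\<Sum>r\<in>periodic_paths G n \<inter> cylinder G v. g p)"
      by simp
    also have "\<dots> = (\<Sum>r\<in>periodic_paths G n \<inter> cylinder G v. g r)"
      by (rule sum.cong[OF refl], rule F_finD[OF g p]) (auto simp: vp mem_cylinder_map_upt)
    finally show ?thesis
      using periodic_paths_cylinder[of v k n] vp by simp
  qed
  then have "fin_trace G k (mult_op g \<circ> (transfer_op G ^^ n)) =
      (\<Sum>v\<in>words G k. \<Sum>p | p \<in> periodic_paths G n \<and> map p [0..<k] = v. g p)"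
    by (simp add: fin_trace_def)
  also have "\<dots> = sum g (periodic_paths G n)"
    by (rule sum.group[OF finite_periodic_paths[OF n] finite_words])
      (auto simp: words_def periodic_paths_def)
  finally show ?thesis .
qed

lemma flat_trace_transfer_op:
  assumes "g \<in> F_fin G k" "1 \<le> n"
  shows "flat_trace G (mult_op g \<circ> (transfer_op G ^^ n)) = sum g (periodic_paths G n)"
proof (rule flat_trace_eqI)
  show "\<forall>\<^sub>F m in sequentially.
      fin_trace G m (mult_op g \<circ> (transfer_op G ^^ n)) = sum g (periodic_paths G n)"
    unfolding eventually_sequentially
    using F_fin_mono[OF assms(1)] fin_trace_transfer_op[OF _ _ assms(2)]
    by (intro exI[where x = "max 1 k"]) simp
qed

text \<open>Sorted by first edge, the periodic paths in one cylinder of length 1 correspond to some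
  of the \<open>q ^ n\<close> preimages of a single point. This growth rate makes the double sum of
  the trace formula absolutely convergent.\<close>

lemma card_periodic_paths_le:
  assumes "1 \<le> n"
  shows "card (periodic_paths G n) \<le> card (words G 1) * q ^ n"
proof -
  have "(\<lambda>p. map p [0..<1]) ` periodic_paths G n \<subseteq> words G 1"
    by (auto simp: words_def periodic_paths_def)
  from sum.group[OF finite_periodic_paths[OF assms] finite_words this, of "\<lambda>_. 1 :: nat"]
  have "card (periodic_paths G n) = (\<Sum>v\<in>words G 1. card {p \<in> periodic_paths G n. map p [0..<1] = v})"
    by simp
  also have "\<dots> \<le> (\<Sum>v\<in>words G 1. q ^ n)"
  proof (rule sum_mono)
    fix v assume v: "v \<in> words G 1"
    define p where "p = (SOME p. p \<in> cylinder G v)"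
    have p: "p \<in> right_paths G" and vp: "v = map p [0..<1]"
      using words_SOME[OF v] by (simp_all add: p_def)
    have "card {p \<in> periodic_paths G n. map p [0..<1] = v} = card (preimages G n p \<inter> cylinder G v)"
      using periodic_paths_cylinder[of v 1 n] bij_betw_same_card[OF bij_betw_periodic_preimages[OF p, of 1 n]]
        assms vp by simp
    also have "\<dots> \<le> card (preimages G n p)"
      by (intro card_mono finite_preimages[OF p]) auto
    finally show "card {p \<in> periodic_paths G n. map p [0..<1] = v} \<le> q ^ n"
      by (simp add: card_preimages[OF p])
  qed
  finally show ?thesis by simp
qed

section \<open>Vanishing of the trace term of index zero\<close>

lemma card_words_extending:
  assumes v: "v \<in> words G k" and k: "1 \<le> k"
  shows "card {u \<in> words G (Suc k). take k u = v} = q"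
proof -
  obtain p where p: "p \<in> right_paths G" and vp: "v = map p [0..<k]"
    using v by (auto simp: words_def)
  have "{u \<in> words G (Suc k). take k u = v} = (\<lambda>e. v @ [e]) ` {e \<in> parcs G. follows (p (k - 1)) e}"
  proof (intro subset_antisym subsetI)
    fix u assume "u \<in> {u \<in> words G (Suc k). take k u = v}"
    then obtain r where r: "r \<in> right_paths G" "u = map r [0..<Suc k]" "take k u = v"
      by (auto simp: words_def)
    then have rv: "map r [0..<k] = v"
      by (simp add: take_map)
    then have "r (k - 1) = p (k - 1)"
      using k unfolding vp map_upt_eq_iff by simp
    then have "follows (p (k - 1)) (r k)"
      using right_paths_follows[OF r(1), of "k - 1"] k by simp
    moreover have "u = v @ [r k]"
      using r(2) rv by simp
    ultimately show "u \<in> (\<lambda>e. v @ [e]) ` {e \<in> parcs G. follows (p (k - 1)) e}"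
      using right_paths_arc[OF r(1), of k] by blast
  next
    fix u assume "u \<in> (\<lambda>e. v @ [e]) ` {e \<in> parcs G. follows (p (k - 1)) e}"
    then obtain e where e: "e \<in> parcs G" "follows (p (k - 1)) e" "u = v @ [e]"
      by blast
    \<comment> \<open>Words are prefixes of infinite paths, so the new edge must itself be continued
      indefinitely.\<close>
    obtain r where r: "r \<in> right_paths G" "r 0 = e"
      using right_path_exists[OF e(1)] .
    have splice: "(\<lambda>i. if i < k then p i else r (i - k)) \<in> right_paths G"
      using p r e by (intro right_paths_splice) auto
    have eq: "u = map (\<lambda>i. if i < k then p i else r (i - k)) [0..<Suc k]"
      using e r by (simp add: vp)
    have "u \<in> words G (Suc k)"
      unfolding words_def
      by (rule image_eqI[where x = "\<lambda>i. if i < k then p i else r (i - k)"]) (fact eq, fact splice)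
    then show "u \<in> {u \<in> words G (Suc k). take k u = v}"
      using e(3) vp by simp
  qed
  moreover have "card ((\<lambda>e. v @ [e]) ` {e \<in> parcs G. follows (p (k - 1)) e}) = q"
    by (subst card_image) (auto intro: inj_onI simp: card_followers[OF right_paths_arc[OF p]])
  ultimately show ?thesis by simp
qed

text \<open>The diagonal entries are the values of \<open>g\<close>, and each word passes its value
  on to \<open>q\<close> extensions.\<close>

lemma fin_trace_mult_op_Suc:
  assumes g: "g \<in> F_fin G k" and k: "1 \<le> k"
  shows "fin_trace G (Suc k) (mult_op g) = q * fin_trace G k (mult_op g)"
proof -
  let ?p = "\<lambda>v. SOME p. p \<in> cylinder G v"
  have trace: "fin_trace G j (mult_op g) = (\<Sum>v\<in>words G j. g (?p v))" for j
    unfolding fin_trace_def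
  proof (rule sum.cong[OF refl])
    fix v assume v: "v \<in> words G j"
    then have "length v = j"
      by (auto simp: words_def)
    then have "?p v \<in> cylinder G v"
      using words_SOME[OF v] by (simp add: cylinder_def)
    then show "op_matrix G (mult_op g) v v = g (?p v)"
      by (simp add: op_matrix_def mult_op_def)
  qed
  have "fin_trace G (Suc k) (mult_op g) = (\<Sum>v\<in>words G k. \<Sum>u | u \<in> words G (Suc k) \<and> take k u = v. g (?p u))"
    unfolding trace
    by (rule sum.group[symmetric, OF finite_words finite_words]) (auto simp: words_def take_map)
  also have "\<dots> = (\<Sum>v\<in>words G k. \<Sum>u | u \<in> words G (Suc k) \<and> take k u = v. g (?p v))"
  proof (intro sum.cong refl)
    fix v u assume v: "v \<in> words G k" and "u \<in> {u. u \<in> words G (Suc k) \<and> take k u = v}"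
    then have u: "u \<in> words G (Suc k)" "take k u = v" by auto
    have "take k (map (?p u) [0..<Suc k]) = v"
      unfolding words_SOME(2)[OF u(1)] by (rule u(2))
    then have "map (?p u) [0..<k] = v"
      by (simp add: take_map)
    then show "g (?p u) = g (?p v)"
      using words_SOME[OF v] words_SOME(1)[OF u(1)] map_upt_eq_iff[of "?p u" k "?p v"]
      by (intro F_finD[OF g]) auto
  qed
  also have "\<dots> = (\<Sum>v\<in>words G k. q * g (?p v))"
    by (rule sum.cong) (auto simp: card_words_extending[OF _ k])
  also have "\<dots> = q * fin_trace G k (mult_op g)"
    by (simp add: trace sum_distrib_left)
  finally show ?thesis .
qed

lemma flat_trace_mult_op:
  assumes "g \<in> F_fin G k"
  shows "flat_trace G (mult_op g) = 0"
proof (cases "\<exists>t. \<forall>\<^sub>F m in sequentially. fin_trace G m (mult_op g) = t")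
  case True
  then obtain t where t: "\<forall>\<^sub>F m in sequentially. fin_trace G m (mult_op g) = t" ..
  then obtain N where N: "\<And>m. m \<ge> N \<Longrightarrow> fin_trace G m (mult_op g) = t"
    by (auto simp: eventually_sequentially)
  \<comment> \<open>The index lies past the stabilisation point and past the memory of
    \<open>g\<close>, and is positive. A stable value would satisfy
    \<open>t = q * t\<close>.\<close>
  have "fin_trace G (Suc (N + k + 1)) (mult_op g) = q * fin_trace G (N + k + 1) (mult_op g)"
    by (rule fin_trace_mult_op_Suc[OF F_fin_mono[OF assms]]) auto
  then have "t = q * t"
    by (simp add: N)
  then have "t = 0"
    using q_gt_1 by auto
  then show ?thesis
    using flat_trace_eqI[OF t] by simp
qed (simp add: flat_trace_def)

end

section \<open>Primitive closed paths and the zeta function\<close>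

text \<open>Meaningful for periodic sequences only, so the lemmas about it carry some period
  \<open>n\<close> as a witness.\<close>

definition min_period :: "(nat \<Rightarrow> 'a) \<Rightarrow> nat" where
  "min_period p = (LEAST n. 1 \<le> n \<and> (\<forall>i. p (i + n) = p i))"

lemma min_period:
  fixes p :: "nat \<Rightarrow> 'a"
  assumes "1 \<le> n" "\<forall>i. p (i + n) = p i"
  shows min_period_pos: "1 \<le> min_period p"
    and min_period_periodic: "\<forall>i. p (i + min_period p) = p i"
    and min_period_le: "min_period p \<le> n"
proof -
  have "1 \<le> min_period p \<and> (\<forall>i. p (i + min_period p) = p i)"
    unfolding min_period_def by (rule LeastI[where k = n]) (use assms in blast)
  then show "1 \<le> min_period p" "\<forall>i. p (i + min_period p) = p i" by blast+
  show "min_period p \<le> n"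
    unfolding min_period_def by (rule Least_le) (use assms in blast)
qed

lemma periodic_iff_min_period_dvd:
  fixes p :: "nat \<Rightarrow> 'a"
  assumes "1 \<le> n" "\<forall>i. p (i + n) = p i"
  shows "(\<forall>i. p (i + m) = p i) \<longleftrightarrow> min_period p dvd m"
proof
  let ?l = "min_period p"
  note l = min_period_pos[OF assms] min_period_periodic[OF assms]
  assume m: "\<forall>i. p (i + m) = p i"
  \<comment> \<open>The remainder of a period is again a period; being smaller than the minimal one,
    it must be 0.\<close>
  have r: "\<forall>i. p (i + m mod ?l) = p i"
  proof
    fix i
    have "p (i + m mod ?l) = p (i + m mod ?l + ?l * (m div ?l))"
      by (rule periodic_add_mult[OF l(2), symmetric])
    also have "i + m mod ?l + ?l * (m div ?l) = i + m"
      by (simp add: add.assoc)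
    finally show "p (i + m mod ?l) = p i"
      using m by simp
  qed
  have "m mod ?l = 0"
  proof (rule ccontr)
    assume "m mod ?l \<noteq> 0"
    then have "?l \<le> m mod ?l"
      by (intro min_period_le[OF _ r]) simp
    moreover have "m mod ?l < ?l"
      using l(1) by simp
    ultimately show False by simp
  qed
  then show "?l dvd m" by presburger
next
  assume "min_period p dvd m"
  then obtain j where "m = min_period p * j" ..
  then show "\<forall>i. p (i + m) = p i"
    using periodic_add_mult[OF min_period_periodic[OF assms]] by simp
qed

lemma min_period_shift:
  fixes p :: "nat \<Rightarrow> 'a"
  assumes "1 \<le> n" "\<forall>i. p (i + n) = p i"
  shows "min_period (\<lambda>i. p (i + k)) = min_period p"
proof -
  have "(\<forall>i. p (i + m + k) = p (i + k)) \<longleftrightarrow> (\<forall>i. p (i + m) = p i)" for m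
  proof (intro iffI allI)
    fix i assume shifted: "\<forall>i. p (i + m + k) = p (i + k)"
    have "k \<le> n * k" using assms(1) by simp
    \<comment> \<open>Moving ahead by the multiple \<open>n * k \<ge> k\<close> of the period makes
      room to undo the shift by \<open>k\<close> on natural numbers.\<close>
    have "p (i + m) = p (i + m + n * k)"
      by (rule periodic_add_mult[OF assms(2), symmetric])
    also have "\<dots> = p ((i + (n * k - k)) + m + k)"
      using \<open>k \<le> n * k\<close> by (intro arg_cong[where f = p]) linarith
    also have "\<dots> = p ((i + (n * k - k)) + k)"
      using shifted by blast
    also have "\<dots> = p (i + n * k)"
      using \<open>k \<le> n * k\<close> by (intro arg_cong[where f = p]) linarith
    also have "\<dots> = p i"
      by (rule periodic_add_mult[OF assms(2)])
    finally show "p (i + m) = p i" .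
  next
    fix i assume "\<forall>i. p (i + m) = p i"
    then show "p (i + m + k) = p (i + k)"
      by (metis add.assoc add.commute)
  qed
  then show ?thesis
    by (simp add: min_period_def)
qed

text \<open>This is the right half of \<open>periodic_path\<close>. Periods, rotations and
  primitivity of a list are all read off from it.\<close>

definition unroll :: "'a list \<Rightarrow> nat \<Rightarrow> 'a" where
  "unroll xs i = xs ! (i mod length xs)"

lemma unroll_periodic: "unroll xs (i + length xs) = unroll xs i"
  by (simp add: unroll_def)

lemma map_unroll: "map (unroll xs) [0..<length xs] = xs"
  by (rule nth_equalityI) (auto simp: unroll_def)

lemma unroll_map_upt:
  assumes "1 \<le> n" "\<forall>i. p (i + n) = p i"
  shows "unroll (map p [0..<n]) = p"
proof
  fix i
  show "unroll (map p [0..<n]) i = p i"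
    using assms periodic_mod[of p n i] by (simp add: unroll_def)
qed

lemma unroll_rotate:
  assumes "xs \<noteq> []"
  shows "unroll (rotate k xs) = (\<lambda>i. unroll xs (i + k))"
proof
  fix i
  have "i mod length xs < length xs"
    using assms by simp
  from nth_rotate[OF this, of k] show "unroll (rotate k xs) i = unroll xs (i + k)"
    by (simp add: unroll_def mod_add_right_eq add.commute)
qed

lemma concat_replicate_map_upt:
  assumes "\<forall>i. p (i + l) = p i"
  shows "concat (replicate k (map p [0..<l])) = map p [0..<k * l]"
proof (induction k)
  case (Suc k)
  have "map p [l..<l + k * l] = map p (map (\<lambda>i. i + l) [0..<k * l])"
    by (simp only: map_add_upt add.commute)
  also have "\<dots> = map p [0..<k * l]"
    using assms by simp
  finally show ?case
    using Suc upt_add_eq_append[of 0 l "k * l"] by simp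
qed simp

text \<open>Moving the window by one trades \<open>h m\<close> for the equal value
  \<open>h (m + l)\<close>. The shift by \<open>m\<close> between \<open>f\<close> and its reduction
  is absorbed in this way.\<close>

lemma sum_periodic_shift:
  fixes h :: "nat \<Rightarrow> 'a :: comm_ring_1"
  assumes "\<And>k. h (k + l) = h k"
  shows "(\<Sum>k<l. h (k + m)) = (\<Sum>k<l. h k)"
proof (induction m)
  case (Suc m)
  have "(\<Sum>k<l. h (k + Suc m)) + h m = (\<Sum>k<Suc l. h (k + m))"
    by (simp only: sum.lessThan_Suc_shift) (simp add: add.commute)
  also have "\<dots> = (\<Sum>k<l. h (k + m)) + h m"
    using assms[of m] by (simp add: add.commute)
  finally show ?case
    using Suc by simp
qed simp

context regular_graph
begin

text \<open>Period 1 would be a loop, and period 2 an edge followed by its reversal. The bound in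
  \<open>closed_path\<close> thus holds automatically, and periodic paths of all positive periods
  match closed paths.\<close>

lemma periodic_length_ge_3:
  assumes "p \<in> periodic_paths G n" "1 \<le> n"
  shows "3 \<le> n"
proof (rule ccontr)
  have p: "p \<in> right_paths G" "p n = p 0"
    using assms by (auto simp: periodic_paths_def dest: spec[where x = 0])
  assume "\<not> 3 \<le> n"
  then consider "n = 1" | "n = 2"
    using assms by linarith
  then show False
  proof cases
    case 1
    then show False
      using right_paths_follows[OF p(1), of 0] p(2) pair_no_loops[OF right_paths_arc[OF p(1), of 0]]
      by (simp add: follows_def)
  next
    case 2
    have "follows (p 0) (p 1)" "follows (p 1) (p 0)"
      using right_paths_follows[OF p(1), of 0] right_paths_follows[OF p(1), of 1] p(2) 2
      by (simp_all add: numeral_2_eq_2)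
    then show False
      by (simp add: follows_def prod_eq_iff)
  qed
qed

text \<open>The condition joining the last edge to the first is admissibility of the infinite
  repetition where it wraps around.\<close>

lemma closed_path_iff: "closed_path G es \<longleftrightarrow> es \<noteq> [] \<and> unroll es \<in> periodic_paths G (length es)"
proof (intro iffI conjI)
  assume es: "closed_path G es"
  then show ne: "es \<noteq> []"
    by (auto simp: closed_path_def)
  have "follows (unroll es i) (unroll es (Suc i))" for i
  proof (cases "Suc (i mod length es) = length es")
    case True
    then have "i mod length es = length es - 1" "Suc i mod length es = 0"
      by (simp_all add: mod_Suc)
    then have "es ! (i mod length es) = last es" "es ! (Suc i mod length es) = hd es"
      using ne by (simp_all add: last_conv_nth hd_conv_nth)
    then show ?thesis
      using es by (simp add: closed_path_def unroll_def)
  next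
    case False
    moreover have "i mod length es < length es"
      using ne by simp
    ultimately show ?thesis
      using es by (simp add: closed_path_def unroll_def successively_conv_nth mod_Suc)
  qed
  moreover have "unroll es i \<in> parcs G" for i
    using es ne by (auto simp: closed_path_def unroll_def)
  ultimately show "unroll es \<in> periodic_paths G (length es)"
    by (simp add: periodic_paths_def right_paths_def unroll_periodic)
next
  assume es: "es \<noteq> [] \<and> unroll es \<in> periodic_paths G (length es)"
  then have p: "unroll es \<in> right_paths G" and len: "3 \<le> length es"
    using periodic_length_ge_3 by (auto simp: periodic_paths_def Suc_le_eq)
  have "es ! i \<in> parcs G" if "i < length es" for i
    using right_paths_arc[OF p, of i] that by (simp add: unroll_def)
  then have "set es \<subseteq> parcs G"
    by (metis in_set_conv_nth subsetI)
  moreover have "follows (es ! i) (es ! Suc i)" if "Suc i < length es" for i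
    using right_paths_follows[OF p, of i] that by (simp add: unroll_def)
  moreover have "follows (last es) (hd es)"
    using right_paths_follows[OF p, of "length es - 1"] es by (simp add: unroll_def last_conv_nth hd_conv_nth)
  ultimately show "closed_path G es"
    using len by (simp add: closed_path_def successively_conv_nth)
qed

text \<open>A repetition has the shorter length as a period. Conversely the minimal period divides
  the length, so the list is a power of its initial segment of that length, which is again a closed
  path.\<close>

lemma primitive_path_iff: "primitive_path G es \<longleftrightarrow> closed_path G es \<and> min_period (unroll es) = length es"
proof (cases "closed_path G es")
  case True
  then have ne: "es \<noteq> []" and p: "unroll es \<in> right_paths G"
    by (auto simp: closed_path_iff periodic_paths_def)
  have len: "1 \<le> length es" "\<forall>i. unroll es (i + length es) = unroll es i"
    using ne by (auto simp: Suc_le_eq unroll_periodic)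
  let ?l = "min_period (unroll es)"
  note l = min_period_pos[OF len] min_period_periodic[OF len]
  have "(\<exists>cs k. closed_path G cs \<and> length cs < length es \<and> es = concat (replicate k cs)) \<longleftrightarrow> ?l < length es"
  proof (intro iffI)
    assume "\<exists>cs k. closed_path G cs \<and> length cs < length es \<and> es = concat (replicate k cs)"
    then obtain cs k where cs: "closed_path G cs" "length cs < length es" "es = concat (replicate k cs)"
      by blast
    have cs_len: "1 \<le> length cs"
      using cs(1) by (simp add: closed_path_def)
    have "es = map (unroll cs) [0..<k * length cs]"
      using concat_replicate_map_upt[of "unroll cs" "length cs" k] cs(3)
      by (simp add: unroll_periodic map_unroll)
    moreover from this have "1 \<le> k * length cs"
      using ne by (cases "k * length cs") auto
    moreover have "\<forall>i. unroll cs (i + k * length cs) = unroll cs i"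
      using periodic_add_mult[of "unroll cs" "length cs"] by (simp add: unroll_periodic mult.commute)
    ultimately have "unroll es = unroll cs"
      using unroll_map_upt[of "k * length cs" "unroll cs"] by simp
    then have "?l \<le> length cs"
      using min_period_le[OF cs_len, of "unroll cs"] by (simp add: unroll_periodic)
    then show "?l < length es"
      using cs(2) by simp
  next
    assume less: "?l < length es"
    define cs where "cs = map (unroll es) [0..<?l]"
    have "?l dvd length es"
      using periodic_iff_min_period_dvd[OF len] len(2) by blast
    then have "length es = length es div ?l * ?l"
      by simp
    then have "concat (replicate (length es div ?l) cs) = es"
      unfolding cs_def concat_replicate_map_upt[OF l(2)] using map_unroll by metis
    moreover have "unroll cs = unroll es"
      unfolding cs_def by (rule unroll_map_upt[OF l])
    then have "closed_path G cs"
      using l p by (auto simp: closed_path_iff periodic_paths_def cs_def)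
    ultimately show "\<exists>cs k. closed_path G cs \<and> length cs < length es \<and> es = concat (replicate k cs)"
      using less by (intro exI[where x = cs] exI[where x = "length es div ?l"]) (simp add: cs_def)
  qed
  then show ?thesis
    using True min_period_le[OF len] by (auto simp: primitive_path_def)
qed (simp add: primitive_path_def)

text \<open>The inverse cuts out one minimal period. Primitive closed paths with a marked starting
  edge thus replace the periodic sequences in the trace.\<close>

lemma bij_betw_unroll: "bij_betw unroll {es. primitive_path G es} (\<Union>n\<in>{1..}. periodic_paths G n)"
proof (rule bij_betw_byWitness[where f' = "\<lambda>p. map p [0..<min_period p]"])
  show "\<forall>es\<in>{es. primitive_path G es}. map (unroll es) [0..<min_period (unroll es)] = es"
    by (simp add: primitive_path_iff map_unroll)
  show "unroll ` {es. primitive_path G es} \<subseteq> (\<Union>n\<in>{1..}. periodic_paths G n)"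
  proof (rule image_subsetI)
    fix es assume "es \<in> {es. primitive_path G es}"
    then have "unroll es \<in> periodic_paths G (length es)" "length es \<in> {1..}"
      by (auto simp: primitive_path_iff closed_path_iff Suc_le_eq)
    then show "unroll es \<in> (\<Union>n\<in>{1..}. periodic_paths G n)" by blast
  qed
  have *: "primitive_path G (map p [0..<min_period p]) \<and> unroll (map p [0..<min_period p]) = p"
    if "p \<in> periodic_paths G n" "1 \<le> n" for p n
  proof -
    have n: "\<forall>i. p (i + n) = p i" and p: "p \<in> right_paths G"
      using that by (auto simp: periodic_paths_def)
    note l = min_period_pos[OF that(2) n] min_period_periodic[OF that(2) n]
    show ?thesis
      using unroll_map_upt[OF l] l p by (simp add: primitive_path_iff closed_path_iff periodic_paths_def)
  qed
  show "\<forall>p\<in>\<Union>n\<in>{1..}. periodic_paths G n. unroll (map p [0..<min_period p]) = p"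
    "(\<lambda>p. map p [0..<min_period p]) ` (\<Union>n\<in>{1..}. periodic_paths G n) \<subseteq> {es. primitive_path G es}"
    using * by (simp_all add: image_subset_iff)
qed

section \<open>Rotation classes and shift orbits\<close>

lemma primitive_path_rotate:
  assumes "primitive_path G es"
  shows "primitive_path G (rotate k es)"
proof -
  have ne: "es \<noteq> []" and p: "unroll es \<in> periodic_paths G (length es)"
    using assms by (auto simp: primitive_path_iff closed_path_iff)
  have len: "1 \<le> length es" "\<forall>i. unroll es (i + length es) = unroll es i"
    using ne by (auto simp: Suc_le_eq unroll_periodic)
  have "unroll es (i + length es + k) = unroll es (i + k)" for i
    using len(2)[rule_format, of "i + k"] by (simp add: ac_simps)
  then have "unroll (rotate k es) \<in> periodic_paths G (length es)"
    using p right_paths_shift[of "unroll es" G k] by (simp add: unroll_rotate[OF ne] periodic_paths_def)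
  moreover have "min_period (unroll (rotate k es)) = length es"
    unfolding unroll_rotate[OF ne] min_period_shift[OF len] using assms by (simp add: primitive_path_iff)
  ultimately show ?thesis
    using ne by (simp add: primitive_path_iff closed_path_iff)
qed

abbreviation rotation_rel :: "(('v \<times> 'v) list \<times> ('v \<times> 'v) list) set" where
  "rotation_rel \<equiv> {(es, fs). primitive_path G es \<and> primitive_path G fs \<and> (\<exists>k. fs = rotate k es)}"

lemma equiv_rotation_rel: "equiv {es. primitive_path G es} rotation_rel"
proof (rule equivI)
  show "refl_on {es. primitive_path G es} rotation_rel"
    by (auto simp: refl_on_def intro: exI[where x = 0])
  show "sym rotation_rel"
  proof (rule symI)
    fix es fs assume "(es, fs) \<in> rotation_rel"
    then obtain k where k: "primitive_path G es" "primitive_path G fs" "fs = rotate k es"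
      by blast
    have "rotate (length es - k mod length es) (rotate (k mod length es) es) = es"
    proof (cases "es = []")
      case False
      then have "k mod length es < length es" by simp
      then show ?thesis by (simp add: rotate_rotate)
    qed simp
    then have "es = rotate (length es - k mod length es) fs"
      using k(3) rotate_conv_mod[of k es] by simp
    then show "(fs, es) \<in> rotation_rel"
      using k by blast
  qed
  show "trans rotation_rel"
  proof (rule transI)
    fix es fs gs assume "(es, fs) \<in> rotation_rel" "(fs, gs) \<in> rotation_rel"
    then show "(es, gs) \<in> rotation_rel"
      by (auto simp: rotate_rotate)
  qed
qed auto

lemma primitive_classes_eq: "primitive_classes G = {es. primitive_path G es} // rotation_rel"
  by (simp add: primitive_classes_def)

lemma primitive_class_eq:
  assumes "c \<in> primitive_classes G" "es \<in> c"
  shows "primitive_path G es" "c = (\<lambda>k. rotate k es) ` {..<length es}"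
proof -
  show es: "primitive_path G es"
    using in_quotient_imp_subset[OF equiv_rotation_rel] assms unfolding primitive_classes_eq by blast
  have ne: "es \<noteq> []"
    using es by (auto simp: primitive_path_iff closed_path_iff)
  obtain x where x: "c = rotation_rel `` {x}"
    using assms(1) unfolding primitive_classes_eq by (rule quotientE)
  then have "(x, es) \<in> rotation_rel"
    using assms(2) by blast
  then have c: "c = rotation_rel `` {es}"
    unfolding x by (rule equiv_class_eq[OF equiv_rotation_rel])
  show "c = (\<lambda>k. rotate k es) ` {..<length es}"
  proof (intro subset_antisym subsetI)
    fix fs assume "fs \<in> c"
    then obtain k where "fs = rotate k es"
      using c by blast
    then have "fs = rotate (k mod length es) es"
      using rotate_conv_mod by metis
    moreover have "k mod length es \<in> {..<length es}"
      using ne by simp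
    ultimately show "fs \<in> (\<lambda>k. rotate k es) ` {..<length es}"
      by blast
  next
    fix fs assume "fs \<in> (\<lambda>k. rotate k es) ` {..<length es}"
    then show "fs \<in> c"
      unfolding c using es primitive_path_rotate by blast
  qed
qed

text \<open>Two coinciding rotations would give the unrolled path a period below its length. A class
  therefore has as many elements as its paths have edges, and an orbit sum is a sum over the
  class.\<close>

lemma inj_on_rotate_primitive:
  assumes es: "primitive_path G es"
  shows "inj_on (\<lambda>k. rotate k es) {..<length es}"
proof -
  have ne: "es \<noteq> []" and l: "min_period (unroll es) = length es"
    using es by (auto simp: primitive_path_iff closed_path_iff)
  have len: "1 \<le> length es" "\<forall>i. unroll es (i + length es) = unroll es i"
    using ne by (auto simp: Suc_le_eq unroll_periodic)
  have "rotate j es \<noteq> rotate k es" if "j < k" "k < length es" for j k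
  proof
    assume eq: "rotate j es = rotate k es"
    have shifted: "unroll es (i + j) = unroll es (i + k)" for i
      using fun_cong[OF arg_cong[OF eq, of unroll], of i] by (simp add: unroll_rotate[OF ne])
    let ?p = "\<lambda>i. unroll es (i + j)"
    have per: "\<forall>i. ?p (i + (k - j)) = ?p i"
      using that by (simp add: shifted)
    have "min_period ?p \<le> k - j"
      by (rule min_period_le[OF _ per]) (use that in simp)
    then show False
      using that min_period_shift[OF len, of j] l by simp
  qed
  then show ?thesis
    by (intro linorder_inj_onI') auto
qed

text \<open>
  The edge in position \<open>i\<close> of the left half of the \<open>k\<close>-th shift is \<open>unroll es (k - 1 - i)\<close> up to
  multiples of the length; adding \<open>(i + 1) * length es\<close> avoids truncated subtraction.
\<close>

lemma bi_shift_periodic_path: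
  assumes "es \<noteq> []"
  shows "(bi_shift ^^ k) (periodic_path es) =
    (\<lambda>i. unroll es (i + k), \<lambda>i. unroll es ((length es - 1) * (i + 1) + k))"
proof (induction k)
  case 0
  have "((length es - 1) * (i + 1)) mod length es = length es - 1 - i mod length es" for i
  proof -
    obtain l where l: "length es = Suc l"
      using assms by (cases es) auto
    have "i mod Suc l \<le> l"
      using mod_less_divisor[of "Suc l" i] by simp
    \<comment> \<open>Modulo \<open>Suc l\<close> the factor \<open>l\<close> is -1, so
      \<open>l * (i + 1)\<close> is congruent to \<open>l - i\<close>. The multiple of
      \<open>Suc l\<close> is made explicit to stay within natural numbers.\<close>
    have "l * (i + 1) + i mod Suc l = l + Suc l * (i - i div Suc l)"
    proof -
      have "i mod Suc l + Suc l * (i div Suc l) = i"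
        by (rule mod_mult_div_eq)
      moreover have "Suc l * (i div Suc l) \<le> Suc l * i"
        by (intro mult_le_mono2) simp
      moreover have "Suc l * i = i + l * i" "l * (i + 1) = l * i + l"
        by simp_all
      ultimately show ?thesis
        unfolding diff_mult_distrib2 by linarith
    qed
    then have "l * (i + 1) = (l - i mod Suc l) + Suc l * (i - i div Suc l)"
      using \<open>i mod Suc l \<le> l\<close> by linarith
    then have "l * (i + 1) mod Suc l = (l - i mod Suc l) mod Suc l"
      by (metis mod_mult_self2)
    then show ?thesis
      by (simp add: l)
  qed
  then show ?case
    by (simp add: periodic_path_def unroll_def fun_eq_iff)
next
  case (Suc k)
  have "case_nat (unroll es k) (\<lambda>i. unroll es ((length es - 1) * (i + 1) + k)) i =
      unroll es ((length es - 1) * (i + 1) + Suc k)" for i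
  proof -
    obtain l where l: "length es = Suc l"
      using assms by (cases es) auto
    \<comment> \<open>One more shift moves the left half back by one place, since the new position
      exceeds \<open>l * i + k\<close> by a full period; for \<open>i = 0\<close> it is the edge
      just crossed.\<close>
    have "unroll es (l * (i + 1) + Suc k) = unroll es (l * i + k + length es)"
      by (intro arg_cong[where f = "unroll es"]) (simp add: l algebra_simps)
    then have "unroll es (l * (i + 1) + Suc k) = unroll es (l * i + k)"
      by (simp only: unroll_periodic)
    then show ?thesis
      by (cases i) (simp_all add: l)
  qed
  then have left: "case_nat (unroll es k) (\<lambda>i. unroll es ((length es - 1) * (i + 1) + k)) =
      (\<lambda>i. unroll es ((length es - 1) * (i + 1) + Suc k))"
    by (rule ext)
  show ?case
    unfolding funpow.simps o_apply Suc
    unfolding bi_shift_def right_shift_def fst_conv snd_conv add_0 left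
    by simp
qed

text \<open>The relation between \<open>f\<close> and its reduction is available on
  \<open>bi_paths\<close> only, so every point of the periodic orbit has to be placed there.\<close>

lemma periodic_path_bi_paths:
  assumes "closed_path G es"
  shows "(bi_shift ^^ k) (periodic_path es) \<in> bi_paths G"
proof -
  have ne: "es \<noteq> []" and p: "unroll es \<in> right_paths G"
    using assms by (auto simp: closed_path_iff periodic_paths_def)
  obtain l where l: "length es = Suc l"
    using ne by (cases es) auto
  have step: "unroll es (Suc (l * Suc i + k)) = unroll es (l * i + k)" for i
  proof -
    have "unroll es (Suc (l * Suc i + k)) = unroll es (l * i + k + length es)"
      by (intro arg_cong[where f = "unroll es"]) (simp add: l)
    then show ?thesis
      by (simp only: unroll_periodic)
  qed
  have follows: "follows (unroll es (l * Suc i + k)) (unroll es (l * i + k))" for i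
    using right_paths_follows[OF p, of "l * Suc i + k"] unfolding step .
  have "(\<lambda>i. unroll es (l * Suc i + k)) \<in> left_paths G"
    using right_paths_arc[OF p] follows unfolding left_paths_def by blast
  moreover have "follows (unroll es (l * Suc 0 + k)) (unroll es (0 + k))"
    using follows[of 0] by simp
  ultimately show ?thesis
    using right_paths_shift[OF p, of k]
    by (simp add: bi_shift_periodic_path[OF ne] bi_paths_def l)
qed

section \<open>Orbit sums and the trace formula\<close>

lemma weight_power: "of_nat q powr (of_nat n * (1 / 2 + \<i> * s)) = weight q s ^ n"
  using q_gt_1 by (simp add: weight_def powr_def exp_of_nat_mult[symmetric] mult.assoc)

text \<open>The chosen representative disappears: the orbit sum runs over all rotations, that is,
  over the class, and the length is the minimal period common to its members. In this form the term
  is a partial sum over periodic sequences.\<close>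

lemma zeta_term_eq:
  assumes c: "c \<in> primitive_classes G"
    and f: "\<And>x. x \<in> bi_paths G \<Longrightarrow> f ((bi_shift ^^ m) x) = g (fst x)"
  shows "zeta_term q f s c = (\<Sum>es\<in>c. weight q s ^ min_period (unroll es) /
      (1 - weight q s ^ min_period (unroll es)) * g (unroll es))"
proof -
  define es where "es = (SOME es. es \<in> c)"
  have "c \<noteq> {}"
    using c in_quotient_imp_non_empty[OF equiv_rotation_rel] unfolding primitive_classes_eq by blast
  then have "es \<in> c"
    unfolding es_def by (simp add: some_in_eq)
  note es = primitive_class_eq(1)[OF c this] and c_eq = primitive_class_eq(2)[OF c this]
  have ne: "es \<noteq> []" and closed: "closed_path G es"
    using es by (auto simp: primitive_path_iff closed_path_iff)
  let ?l = "length es" and ?h = "\<lambda>k. f ((bi_shift ^^ k) (periodic_path es))"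
  have per: "?h (k + ?l) = ?h k" for k
  proof -
    have "(bi_shift ^^ (k + ?l)) (periodic_path es) = (bi_shift ^^ k) (periodic_path es)"
      unfolding bi_shift_periodic_path[OF ne] add.assoc[symmetric] unroll_periodic ..
    then show ?thesis by simp
  qed
  have shift: "?h (k + m) = g (unroll (rotate k es))" for k
    using f[OF periodic_path_bi_paths[OF closed, of k]]
    by (simp add: funpow_add[of m k, unfolded o_def add.commute[of m]] bi_shift_periodic_path[OF ne] unroll_rotate[OF ne])
  have "(\<Sum>k<?l. ?h k) = (\<Sum>k<?l. g (unroll (rotate k es)))"
    using sum_periodic_shift[of ?h ?l m, OF per] by (simp only: shift)
  moreover have "of_nat q powr ((1 / 2 + \<i> * s) * of_nat ?l) = weight q s ^ ?l"
    using weight_power[of ?l s] by (simp only: mult.commute)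
  ultimately have "zeta_term q f s c =
      (\<Sum>k<?l. weight q s ^ ?l / (1 - weight q s ^ ?l) * g (unroll (rotate k es)))"
    unfolding zeta_term_def es_def[symmetric] Let_def by (simp only: sum_distrib_left)
  also have "\<dots> = (\<Sum>k<?l. weight q s ^ min_period (unroll (rotate k es)) /
      (1 - weight q s ^ min_period (unroll (rotate k es))) * g (unroll (rotate k es)))"
    using primitive_path_rotate[OF es] by (simp add: primitive_path_iff)
  also have "\<dots> = (\<Sum>es\<in>c. weight q s ^ min_period (unroll es) /
      (1 - weight q s ^ min_period (unroll es)) * g (unroll es))"
    unfolding c_eq by (simp add: sum.reindex[OF inj_on_rotate_primitive[OF es]])
  finally show ?thesis .
qed

lemma finite_primitive_class: "c \<in> primitive_classes G \<Longrightarrow> finite c"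
  using primitive_class_eq(2) by (cases "c = {}") (blast, metis ex_in_conv finite_imageI finite_lessThan)

text \<open>Both sides are iterated sums of one family \<open>H\<close> over pairs of a period and a
  path with that period. Stating them with a common sum \<open>S\<close> delivers summability
  together with equality.\<close>

lemma trace_formula:
  assumes g: "g \<in> F_fin G k" and s: "Im s > 3 / 2"
    and f: "\<And>x. x \<in> bi_paths G \<Longrightarrow> f ((bi_shift ^^ m) x) = g (fst x)"
  obtains S where "resolvent_trace_term G q g s sums S"
    and "(zeta_term q f s has_sum S) (primitive_classes G)"
proof -
  define w where "w = weight q s"
  define H where "H = (\<lambda>(n, p). w ^ n * g p)"
  let ?r = "cmod w * q"
  have r: "?r < 1"
    unfolding w_def by (rule cmod_weight_less[OF s])
  have w1: "cmod w < 1"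
  proof -
    have "cmod w * 1 \<le> ?r"
      using q_gt_1 by (intro mult_left_mono) auto
    then show ?thesis using r by linarith
  qed
  obtain M where M: "\<And>p. p \<in> right_paths G \<Longrightarrow> cmod (g p) \<le> M"
    by (rule F_fin_bounded[OF g]) blast
  have M0: "0 \<le> M"
    using M right_paths_nonempty norm_ge_zero order_trans by blast
  have bound: "(\<Sum>p\<in>periodic_paths G n. cmod (w ^ n * g p)) \<le> card (words G 1) * M * ?r ^ n"
    if n: "1 \<le> n" for n
  proof -
    have "(\<Sum>p\<in>periodic_paths G n. cmod (w ^ n * g p)) \<le> (\<Sum>p\<in>periodic_paths G n. cmod w ^ n * M)"
      by (rule sum_mono) (auto simp: norm_mult norm_power periodic_paths_def intro!: mult_left_mono M)
    also have "\<dots> = card (periodic_paths G n) * (cmod w ^ n * M)"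
      by simp
    also have "\<dots> \<le> (card (words G 1) * q ^ n) * (cmod w ^ n * M)"
      using card_periodic_paths_le[OF n] M0
      by (intro mult_right_mono) (simp_all flip: of_nat_mult of_nat_power)
    finally show ?thesis
      by (simp add: power_mult_distrib ac_simps)
  qed
  have "(\<lambda>x. norm (H x)) summable_on Sigma {1..} (periodic_paths G)"
  proof (rule Infinite_Sum.abs_summable_on_Sigma_iff[THEN iffD2], intro conjI ballI)
    show "(\<lambda>p. norm (H (n, p))) summable_on periodic_paths G n" if "n \<in> {1..}" for n
      using that finite_periodic_paths[of n] by simp
    have "(\<lambda>n. card (words G 1) * M * ?r ^ n) summable_on UNIV"
      using r M0 by (intro summable_on_UNIV_nonneg_real_iff[THEN iffD2] summable_mult summable_geometric) auto
    then have "(\<lambda>n. card (words G 1) * M * ?r ^ n) summable_on {1..}"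
      by (rule summable_on_subset_banach) simp
    then show "(\<lambda>n. norm (\<Sum>\<^sub>\<infinity>p\<in>periodic_paths G n. norm (H (n, p)))) summable_on {1..}"
      by (rule summable_on_comparison_test)
        (use bound in \<open>auto simp: finite_periodic_paths H_def sum_nonneg\<close>)
  qed
  then obtain S where S: "(H has_sum S) (Sigma {1..} (periodic_paths G))"
    using Infinite_Sum.abs_summable_summable by (auto simp: summable_on_def)
  have "((\<lambda>n. w ^ n * sum g (periodic_paths G n)) has_sum S) {1..}"
    by (rule has_sum_SigmaD[OF S]) (simp add: H_def finite_periodic_paths sum_distrib_left)
  \<comment> \<open>The pairs start at period 1; the missing index 0 is harmless because
    \<open>flat_trace_mult_op\<close> makes its trace term vanish.\<close>
  then have "(resolvent_trace_term G q g s has_sum S) UNIV"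
  proof (rule has_sum_cong_neutral[THEN iffD2, rotated -1])
    show "resolvent_trace_term G q g s n = 0" if "n \<in> UNIV - {1..}" for n
    proof -
      have "n = 0" using that by auto
      then show ?thesis
        using flat_trace_mult_op[OF g] by (simp add: resolvent_trace_term_def comp_def id_def)
    qed
    show "resolvent_trace_term G q g s n = w ^ n * sum g (periodic_paths G n)"
      if "n \<in> UNIV \<inter> {1..}" for n
      unfolding resolvent_trace_term_def weight_power w_def
      using that by (subst flat_trace_transfer_op[OF g]) auto
  qed simp
  then have trace: "resolvent_trace_term G q g s sums S"
    by (rule has_sum_imp_sums)
  let ?Per = "\<Union>n\<in>{1..}. periodic_paths G n"
  let ?F = "\<lambda>p. w ^ min_period p / (1 - w ^ min_period p) * g p"
  have swapped: "((\<lambda>(p, n). H (n, p)) has_sum S) (Sigma ?Per (\<lambda>p. {n. 1 \<le> n \<and> p \<in> periodic_paths G n}))"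
    using S by (rule has_sum_reindex_bij_witness[where i = prod.swap and j = prod.swap, THEN iffD1, rotated -1]) auto
  have "(?F has_sum S) ?Per"
  proof (rule has_sum_SigmaD[OF swapped])
    fix p assume "p \<in> ?Per"
    then obtain n where n: "1 \<le> n" "\<forall>i. p (i + n) = p i" and p: "p \<in> right_paths G"
      by (auto simp: periodic_paths_def)
    let ?l = "min_period p"
    have l: "1 \<le> ?l"
      by (rule min_period_pos[OF n])
    have "cmod (w ^ ?l) < 1"
      using l w1 by (simp add: norm_power power_less_one_iff)
    from has_sum_geometric_from_1[OF this]
    have "((\<lambda>j. w ^ (?l * j)) has_sum (w ^ ?l / (1 - w ^ ?l))) {1..}"
      by (simp add: power_mult)
    \<comment> \<open>The periods of \<open>p\<close> are the positive multiples of its minimal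
      period, so the inner sum is geometric in \<open>w ^ ?l\<close>.\<close>
    moreover have "bij_betw (\<lambda>j. ?l * j) {1..} {n. 1 \<le> n \<and> p \<in> periodic_paths G n}"
    proof (rule bij_betwI')
      fix j assume "j \<in> {1::nat..}"
      then show "?l * j \<in> {n. 1 \<le> n \<and> p \<in> periodic_paths G n}"
        using l p periodic_iff_min_period_dvd[OF n, of "?l * j"] by (auto simp: periodic_paths_def)
    next
      fix n' assume n': "n' \<in> {n. 1 \<le> n \<and> p \<in> periodic_paths G n}"
      then have "?l dvd n'"
        using periodic_iff_min_period_dvd[OF n, of n'] by (simp add: periodic_paths_def)
      then obtain j where j: "n' = ?l * j" ..
      with n' have "j \<in> {1..}" by (cases j) auto
      with j show "\<exists>j\<in>{1..}. n' = ?l * j" by blast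
    qed (use l in auto)
    ultimately have "((\<lambda>n. w ^ n) has_sum (w ^ ?l / (1 - w ^ ?l))) {n. 1 \<le> n \<and> p \<in> periodic_paths G n}"
      using has_sum_reindex_bij_betw[of "\<lambda>j. ?l * j" _ _ "\<lambda>n. w ^ n"] by blast
    then have "((\<lambda>n. w ^ n * g p) has_sum ?F p) {n. 1 \<le> n \<and> p \<in> periodic_paths G n}"
      by (rule has_sum_cmult_left)
    then show "((\<lambda>n. (\<lambda>(p, n). H (n, p)) (p, n)) has_sum ?F p) {n. 1 \<le> n \<and> p \<in> periodic_paths G n}"
      by (simp add: H_def)
  qed
  then have prim: "((\<lambda>es. ?F (unroll es)) has_sum S) {es. primitive_path G es}"
    using has_sum_reindex_bij_betw[OF bij_betw_unroll, of ?F] by blast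
  \<comment> \<open>Each primitive path is tagged with its class. Disjointness of the classes makes
    the tag unique, so the sum over paths can be grouped by class.\<close>
  have "bij_betw snd (Sigma (primitive_classes G) (\<lambda>c. c)) {es. primitive_path G es}"
  proof (rule bij_betw_imageI)
    show "inj_on snd (Sigma (primitive_classes G) (\<lambda>c. c))"
      using quotient_disj[OF equiv_rotation_rel] unfolding primitive_classes_eq by (auto simp: inj_on_def)
    have "snd ` Sigma (primitive_classes G) (\<lambda>c. c) = \<Union>(primitive_classes G)"
      by force
    then show "snd ` Sigma (primitive_classes G) (\<lambda>c. c) = {es. primitive_path G es}"
      unfolding primitive_classes_eq Union_quotient[OF equiv_rotation_rel] .
  qed
  from has_sum_reindex_bij_betw[OF this, of "\<lambda>es. ?F (unroll es)"] prim
  have "((\<lambda>x. ?F (unroll (snd x))) has_sum S) (Sigma (primitive_classes G) (\<lambda>c. c))"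
    by blast
  then have "(zeta_term q f s has_sum S) (primitive_classes G)"
  proof (rule has_sum_SigmaD)
    fix c assume c: "c \<in> primitive_classes G"
    show "((\<lambda>es. ?F (unroll (snd (c, es)))) has_sum zeta_term q f s c) c"
      unfolding w_def snd_conv
      by (rule has_sum_finiteI[OF finite_primitive_class[OF c]], rule zeta_term_eq[OF c], rule f)
  qed
  with trace show thesis
    by (rule that)
qed

end

text \<open>The inverse, the flat trace and the two infinite sums are total functions with default
  or unspecified values. The further conjuncts certify that the resolvent is a genuine bounded
  inverse given by its Neumann series, that the traces of positive powers are actual matrix traces,
  and that both sums converge, so the final equation has its intended meaning.\<close>

theorem proposition4p11:
  fixes G :: "'v pair_pre_digraph" and q m :: nat and \<theta> :: real and s :: complex
    and f :: "'v bi_path \<Rightarrow> complex" and f_plus :: "(nat \<Rightarrow> 'v \<times> 'v) \<Rightarrow> complex"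
  assumes "pair_graph G"
    and "Digraph_Component.connected G"
    and "\<And>v. v \<in> pverts G \<Longrightarrow> out_degree G v = q + 1"
    and "q > 1"
    and "0 < \<theta>" and "\<theta> < 1"
    and "f \<in> C_lc (bi_top G)"
    and "f_plus \<in> C_lc (right_top G)"
    and "m \<ge> 1"
    and "\<And>x. x \<in> bi_paths G \<Longrightarrow> f ((bi_shift ^^ m) x) = f_plus (fst x)"
    and "Im s > 3 / 2"
  shows "f_plus \<in> F_theta G \<theta> \<and> bounded_op G \<theta> (mult_op f_plus) \<and>
     bij_betw (id_minus_transfer G q s) (F_theta G \<theta>) (F_theta G \<theta>) \<and>
     bounded_op G \<theta> (resolvent G q \<theta> s) \<and>
     op_tendsto G \<theta> (neumann_sum G q s) (resolvent G q \<theta> s) \<and>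
     (\<forall>n\<ge>1. \<forall>k\<ge>1. f_plus \<in> F_fin G k \<longrightarrow>
        fin_trace G k (mult_op f_plus \<circ> (transfer_op G ^^ n)) =
        flat_trace G (mult_op f_plus \<circ> (transfer_op G ^^ n))) \<and>
     summable (resolvent_trace_term G q f_plus s) \<and>
     zeta_term q f s summable_on primitive_classes G \<and>
     resolvent_trace G q f_plus s = zeta G q f s"
proof -
  \<comment> \<open>Connectedness is defined through strong connectedness, which includes a nonempty
    vertex set.\<close>
  have "pverts G \<noteq> {}"
    using assms(2) by (simp add: Digraph_Component.connected_def strongly_connected_def)
  then interpret regular_graph G q
    using assms by (intro regular_graph.intro regular_graph_axioms.intro) auto
  obtain k where k: "f_plus \<in> F_fin G k"
    using C_lc_right_top_F_fin[OF assms(8)] by blast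
  obtain M where "\<And>p. p \<in> right_paths G \<Longrightarrow> cmod (f_plus p) \<le> M"
    by (rule F_fin_bounded[OF k]) blast
  then have F: "f_plus \<in> F_theta G \<theta>"
    by (rule F_fin_F_theta[OF k assms(5,6)])
  obtain S where "resolvent_trace_term G q f_plus s sums S"
    "(zeta_term q f s has_sum S) (primitive_classes G)"
    by (rule trace_formula[OF k assms(11,10)])
  then have "summable (resolvent_trace_term G q f_plus s)"
    "zeta_term q f s summable_on primitive_classes G"
    "resolvent_trace G q f_plus s = zeta G q f s"
    by (auto simp: resolvent_trace_def zeta_def sums_iff summable_on_def infsumI)
  moreover have "fin_trace G k (mult_op f_plus \<circ> (transfer_op G ^^ n)) =
      flat_trace G (mult_op f_plus \<circ> (transfer_op G ^^ n))"
    if "f_plus \<in> F_fin G k" "1 \<le> k" "1 \<le> n" for k n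
    using fin_trace_transfer_op[OF that] flat_trace_transfer_op[OF that(1,3)] by simp
  ultimately show ?thesis
    using F bounded_op_mult_op[OF F assms(5,6)] resolvent_properties[OF assms(11,5,6)] by blast
qed

end
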